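(* Suppose that $(X,Y),(X_i,Y_i)_{i\ge 1}$ are independent and identically distributed with common distribution $P$ on $\mathbb R^d\times S$ and that $X$ has density $f_X$ with respect to Lebesgue measure on $\mathbb R^d$. Let $x\in\mathbb R^d$ and assume that $f_X$ is continuous at $x$ and $f_X(x)>0$. Let $\mathcal G$ be a class of real-valued measurable functions on $(S,\mathcal S)$. Suppose there are $\delta>0$ and an envelope $G$ for $\mathcal G$ such that: (i) for any positive sequence $(\delta_n)_{n\ge1}$ going to $0$, $\limsup_{n\ge 1}\ \sup_{0<u\le\delta} J(\mathcal G,L_2(\mu_{x,u}),\delta_n)=0$ (with $J$ normalized by $G$); (ii) for all $\epsilon>0$ there is $M>0$ such that $\sup_{0<u\le\delta}\mu_{x,u}(G^2\mathbf 1_{\{G>M\}})\le\epsilon$; (iii) $(\mathcal G,\rho_\delta)$ is totally bounded, where $\rho_\delta(g_1,g_2)=\sup_{0<u\le\delta}\|g_1-g_2\|_{L_2(\mu_{x,u})}$. Suppose also that for any pair $(g_1,g_2)$ in $\mathcal G$, the map $z\mapsto(\mu_z(g_1g_2),\mu_z(g_1),\mu_z(G^2))$ is continuous at $x$, and that $k:=k_n$ satisfies $k\to\infty$ and $k/n\to0$. (a) If there are $\tau>0$ and $L_{1,x}>0$ such that $\sup_{g\in\mathcal G}|(\mu_x-\mu_z)(g)|\le L_{1,x}\|x-z\|$ for all $z\in B(x,\tau)$, then $$\sup_{g\in\mathcal G}\left|k^{-1}\sum_{i\in N_{n,k}(x)}(\mu_{X_i}(g)-\mu_x(g))\right|=O_P((k/n)^{1/d})+o_P(k^{-1/2}).$$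 (b) If moreover (in addition to the condition in (a)) for each $g\in\mathcal G$ the map $z\mapsto\mu_z(g)$ is differentiable around $x$ and there are $\tau>0$ and $L_{2,x}>0$ such that $\sup_{g\in\mathcal G}\|\nabla_x\mu_x(g)-\nabla_x\mu_z(g)\|\le L_{2,x}\|x-z\|$ for all $z\in B(x,\tau)$, and $f_X$ is $L_{f,x}$-Lipschitz around $x$ for some constant $L_{f,x}$, then $$\sup_{g\in\mathcal G}\left|k^{-1}\sum_{i\in N_{n,k}(x)}(\mu_{X_i}(g)-\mu_x(g))\right|=O_P((k/n)^{2/d})+o_P(k^{-1/2}).$$
   Context: $(S,\mathcal S)$ is a measurable space. $\mathbb R^d$ carries the Euclidean norm $\|\cdot\|$, and $B(x,\tau)=\{z:\|x-z\|\le\tau\}$. $P_X$ is the law of $X$. $\mu_x$ denotes the regular conditional distribution of $Y$ given $X=x$ (assumed to exist): $\mu_x$ is a probability measure on $(S,\mathcal S)$ for $P_X$-almost every $x$, $x\mapsto\mu_x(A)$ is measurable for each $A\in\mathcal S$, and $\mathbb P(Y\in A,X\in B)=\int_B\mu_x(A)f_X(x)\,dx$ for all $A\in\mathcal S$ and Borel $B$. For a measure $\mu$ and function $g$, $\mu(g)=\int g\,d\mu$. $\nabla_x\mu_z(g)$ denotes the gradient, evaluated at the point $z$, of the function $w\mapsto\mu_w(g)$ on $\mathbb R^d$. $N_{n,k}(x)$ is the index set of the $k$ nearest neighbors of $x$ among $X_1,\dots,X_n$, $1\le k\le n$ (ties broken by lexicographic order). For $u>0$, $\mu_{x,u}$ is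 the probability measure on $(S,\mathcal S)$ given by $\mu_{x,u}(A)=E[\mu_X(A)\mathbf 1_{B(x,u^{1/d})}(X)]/E[\mathbf 1_{B(x,u^{1/d})}(X)]$. An envelope for $\mathcal G$ is a measurable function $G:S\to\mathbb R$ with $|g(s)|\le G(s)$ for all $s\in S$, $g\in\mathcal G$. For a probability measure $Q$ on $(S,\mathcal S)$, $L_2(Q)$ is the set of $g:S\to\mathbb R$ with $\|g\|_{L_2(Q)}^2=Q(g^2)<\infty$. For $\underline f,\overline f\in L_2(Q)$, the bracket $[\underline f,\overline f]$ is the set of $g\in L_2(Q)$ with $\underline f\le g\le\overline f$; it is an $\epsilon$-bracket if $\|\underline f-\overline f\|_{L_2(Q)}\le\epsilon$. The bracketing number $\mathcal N_{[\,]}(\mathcal G,L_2(Q),\epsilon)$ is the smallest number of $\epsilon$-brackets needed to cover $\mathcal G$. The bracketing integral is $$J(\mathcal G,L_2(Q),\delta)=\int_0^\delta\sqrt{\log\mathcal N_{[\,]}(\mathcal G,L_2(Q),\epsilon\|G\|_{L_2(Q)})}\,d\epsilon.$$ For nonnegative random $Z_n$ and positive numbers $a_n$: $Z_n=o_P(a_n)$ if $P(Z_n>a_n\epsilon)\to0$ for any $\epsilon>0$; $Z_n=O_P(a_n)$ if for any $\epsilon>0$ there is $A>0$ such that $P(Z_n>Aa_n)\le\epsilon$ for all sufficiently large $n$. An equality $Z_n=O_P(a_n)+o_P(b_n)$ means $Z_n$ is bounded by a sum of two such terms. *)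

theory Defs
  imports "HOL-Probability.Probability"
begin

section \<open>Regular conditional distributions and their local averages\<close>

text \<open>
  \<open>\<mu> z\<close> is the conditional law of \<open>Y\<close> given \<open>X = z\<close>, where \<open>X\<close> has Lebesgue density \<open>f\<close>.
  Each \<open>\<mu> z\<close> is a measure on \<open>S\<close>; it is only required to be a probability measure for
  almost every \<open>z\<close> with respect to the law of \<open>X\<close>.
\<close>

definition regular_conditional_distribution ::
    "'w measure \<Rightarrow> ('w \<Rightarrow> real ^ 'd) \<Rightarrow> (real ^ 'd \<Rightarrow> real) \<Rightarrow> 's measure \<Rightarrow> ('w \<Rightarrow> 's)
      \<Rightarrow> (real ^ 'd \<Rightarrow> 's measure) \<Rightarrow> bool" where
  "regular_conditional_distribution M X f S Y \<mu> \<longleftrightarrow>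
     (\<forall>z. sets (\<mu> z) = sets S) \<and>
     (AE z in distr M borel X. prob_space (\<mu> z)) \<and>
     (\<forall>A\<in>sets S. (\<lambda>z. emeasure (\<mu> z) A) \<in> borel_measurable borel) \<and>
     (\<forall>A\<in>sets S. \<forall>B\<in>sets borel.
        emeasure M {\<omega> \<in> space M. Y \<omega> \<in> A \<and> X \<omega> \<in> B}
          = (\<integral>\<^sup>+z\<in>B. emeasure (\<mu> z) A * ennreal (f z) \<partial>lborel))"

text \<open>The measure \<open>\<mu>\<^bsub>x,u\<^esub>\<close>: the average of \<open>\<mu>\<^bsub>X\<^esub>\<close> over the ball of radius \<open>u\<^bsup>1/d\<^esup>\<close>.\<close>

definition local_law ::
    "'w measure \<Rightarrow> ('w \<Rightarrow> real ^ 'd) \<Rightarrow> 's measure \<Rightarrow> (real ^ 'd \<Rightarrow> 's measure)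
      \<Rightarrow> real ^ 'd \<Rightarrow> real \<Rightarrow> 's measure" where
  "local_law M X S \<mu> x u =
     measure_of (space S) (sets S)
       (\<lambda>A. (\<integral>\<^sup>+\<omega>. emeasure (\<mu> (X \<omega>)) A * indicator (cball x (u powr (1 / real CARD('d)))) (X \<omega>) \<partial>M)
            / (\<integral>\<^sup>+\<omega>. indicator (cball x (u powr (1 / real CARD('d)))) (X \<omega>) \<partial>M))"

lemma space_local_law [simp]: "space (local_law M X S \<mu> x u) = space S"
  and sets_local_law [simp]: "sets (local_law M X S \<mu> x u) = sets S"
  by (simp_all add: local_law_def)

lemma emeasure_local_law:
  fixes X :: "'w \<Rightarrow> real ^ 'd" and S :: "'s measure"
  assumes X: "X \<in> borel_measurable M"
    and \<mu>: "regular_conditional_distribution M X f S Y \<mu>"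
    and A: "A \<in> sets S"
  shows "emeasure (local_law M X S \<mu> x u) A =
     (\<integral>\<^sup>+\<omega>. emeasure (\<mu> (X \<omega>)) A * indicator (cball x (u powr (1 / real CARD('d)))) (X \<omega>) \<partial>M)
       / (\<integral>\<^sup>+\<omega>. indicator (cball x (u powr (1 / real CARD('d)))) (X \<omega>) \<partial>M)"
proof -
  have sets_\<mu>: "sets (\<mu> z) = sets S" for z
    using \<mu> unfolding regular_conditional_distribution_def by blast
  have meas_\<mu>: "(\<lambda>\<omega>. emeasure (\<mu> (X \<omega>)) B) \<in> borel_measurable M" if "B \<in> sets S" for B
  proof (rule measurable_compose[OF X])
    show "(\<lambda>z. emeasure (\<mu> z) B) \<in> borel_measurable borel"
      using \<mu> that unfolding regular_conditional_distribution_def by blast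
  qed
  let ?I = "\<lambda>\<omega>. indicator (cball x (u powr (1 / real CARD('d)))) (X \<omega>) :: ennreal"
  let ?D = "\<integral>\<^sup>+\<omega>. ?I \<omega> \<partial>M"
  show ?thesis
  proof (rule emeasure_measure_of[OF local_law_def sets.space_closed, unfolded sets_local_law])
    show "positive (sets S) (\<lambda>A. (\<integral>\<^sup>+\<omega>. emeasure (\<mu> (X \<omega>)) A * ?I \<omega> \<partial>M) / ?D)"
      by (simp add: positive_def)
    show "countably_additive (sets S) (\<lambda>A. (\<integral>\<^sup>+\<omega>. emeasure (\<mu> (X \<omega>)) A * ?I \<omega> \<partial>M) / ?D)"
    proof (rule countably_additiveI)
      fix F :: "nat \<Rightarrow> 's set"
      assume F: "range F \<subseteq> sets S" "disjoint_family F"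
      have "emeasure (\<mu> z) (\<Union>i. F i) = (\<Sum>i. emeasure (\<mu> z) (F i))" for z
        using F by (intro suminf_emeasure[symmetric]) (simp_all only: sets_\<mu>)
      then have "(\<integral>\<^sup>+\<omega>. emeasure (\<mu> (X \<omega>)) (\<Union>i. F i) * ?I \<omega> \<partial>M)
          = (\<integral>\<^sup>+\<omega>. (\<Sum>i. emeasure (\<mu> (X \<omega>)) (F i) * ?I \<omega>) \<partial>M)"
        by (simp only: ennreal_suminf_multc)
      also have "\<dots> = (\<Sum>i. \<integral>\<^sup>+\<omega>. emeasure (\<mu> (X \<omega>)) (F i) * ?I \<omega> \<partial>M)"
      proof (rule nn_integral_suminf)
        fix i
        have "F i \<in> sets S" using F by blast
        moreover have "?I \<in> borel_measurable M"
          by (rule measurable_compose[OF X], rule borel_measurable_indicator) simp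
        ultimately show "(\<lambda>\<omega>. emeasure (\<mu> (X \<omega>)) (F i) * ?I \<omega>) \<in> borel_measurable M"
          by (intro borel_measurable_times_ennreal meas_\<mu>)
      qed
      finally show "(\<Sum>i. (\<integral>\<^sup>+\<omega>. emeasure (\<mu> (X \<omega>)) (F i) * ?I \<omega> \<partial>M) / ?D)
          = (\<integral>\<^sup>+\<omega>. emeasure (\<mu> (X \<omega>)) (\<Union>i. F i) * ?I \<omega> \<partial>M) / ?D"
        by (simp only: divide_ennreal_def ennreal_suminf_multc)
    qed
  qed (use A in auto)
qed


section \<open>Bracketing\<close>

text \<open>
  Norms, bracketing numbers and bracketing integrals take values in \<^typ>\<open>ennreal\<close> or
  \<^typ>\<open>enat\<close>, so that infinite values are represented as such.
\<close>

definition L2_norm :: "'s measure \<Rightarrow> ('s \<Rightarrow> real) \<Rightarrow> ennreal" where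
  "L2_norm Q g =
     (let I = \<integral>\<^sup>+s. ennreal ((g s)\<^sup>2) \<partial>Q in if I = \<top> then \<top> else ennreal (sqrt (enn2real I)))"

definition L2 :: "'s measure \<Rightarrow> ('s \<Rightarrow> real) set" where
  "L2 Q = {g \<in> borel_measurable Q. L2_norm Q g < \<top>}"

definition bracket :: "'s measure \<Rightarrow> ('s \<Rightarrow> real) \<Rightarrow> ('s \<Rightarrow> real) \<Rightarrow> ('s \<Rightarrow> real) set" where
  "bracket Q l u = {g \<in> L2 Q. \<forall>s\<in>space Q. l s \<le> g s \<and> g s \<le> u s}"

definition bracketing_number :: "('s \<Rightarrow> real) set \<Rightarrow> 's measure \<Rightarrow> ennreal \<Rightarrow> enat" where
  "bracketing_number \<G> Q \<epsilon> =
     Inf {enat (card \<B>) | \<B>. finite \<B> \<and>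
            (\<forall>(l, u)\<in>\<B>. l \<in> L2 Q \<and> u \<in> L2 Q \<and> L2_norm Q (\<lambda>s. l s - u s) \<le> \<epsilon>) \<and>
            \<G> \<subseteq> (\<Union>(l, u)\<in>\<B>. bracket Q l u)}"

definition sqrt_log :: "enat \<Rightarrow> ennreal" where
  "sqrt_log N = (case N of enat n \<Rightarrow> ennreal (sqrt (ln (real n))) | \<infinity> \<Rightarrow> \<top>)"

definition envelope :: "'s measure \<Rightarrow> ('s \<Rightarrow> real) set \<Rightarrow> ('s \<Rightarrow> real) \<Rightarrow> bool" where
  "envelope S \<G> G \<longleftrightarrow> G \<in> borel_measurable S \<and> (\<forall>g\<in>\<G>. \<forall>s\<in>space S. \<bar>g s\<bar> \<le> G s)"

definition bracketing_integral ::
    "('s \<Rightarrow> real) set \<Rightarrow> ('s \<Rightarrow> real) \<Rightarrow> 's measure \<Rightarrow> real \<Rightarrow> ennreal" where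
  "bracketing_integral \<G> G Q \<delta> =
     (\<integral>\<^sup>+\<epsilon>\<in>{0<..\<delta>}. sqrt_log (bracketing_number \<G> Q (ennreal \<epsilon> * L2_norm Q G)) \<partial>lborel)"

text \<open>
  Total boundedness for an \<^typ>\<open>ennreal\<close>-valued pseudometric; \<^locale>\<open>Metric_space\<close> would
  force points at distance zero to be equal.
\<close>

definition totally_bounded_wrt :: "'a set \<Rightarrow> ('a \<Rightarrow> 'a \<Rightarrow> ennreal) \<Rightarrow> bool" where
  "totally_bounded_wrt A \<rho> \<longleftrightarrow>
     (\<forall>\<epsilon>>0. \<exists>F. finite F \<and> F \<subseteq> A \<and> (\<forall>a\<in>A. \<exists>b\<in>F. \<rho> a b < ennreal \<epsilon>))"


section \<open>Nearest neighbours\<close>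

text \<open>
  The indices among \<open>1, \<dots>, n\<close> of the \<open>k\<close> points \<open>p i\<close> closest to \<open>x\<close>: those of rank below \<open>k\<close>
  in the lexicographic order on pairs \<open>(dist x (p i), i)\<close>, so that ties in the distance are
  resolved by the index.
\<close>

definition nearest_neighbors :: "(nat \<Rightarrow> 'a::metric_space) \<Rightarrow> nat \<Rightarrow> nat \<Rightarrow> 'a \<Rightarrow> nat set" where
  "nearest_neighbors p n k x =
     {i \<in> {1..n}.
        card {j \<in> {1..n}. dist x (p j) < dist x (p i) \<or> dist x (p j) = dist x (p i) \<and> j < i} < k}"


section \<open>Gradients\<close>

definition gradient :: "('a::euclidean_space \<Rightarrow> real) \<Rightarrow> 'a \<Rightarrow> 'a" where
  "gradient h z = (THE D. GDERIV h z :> D)"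

lemma GDERIV_gradient:
  assumes "h differentiable at z"
  shows "GDERIV h z :> gradient h z"
proof -
  obtain h' where h': "(h has_derivative h') (at z)"
    using assms by (auto simp: differentiable_def)
  interpret bounded_linear h' by (rule has_derivative_bounded_linear[OF h'])
  have "h' v = v \<bullet> (\<Sum>b\<in>Basis. h' b *\<^sub>R b)" for v
  proof -
    have "h' v = h' (\<Sum>b\<in>Basis. (v \<bullet> b) *\<^sub>R b)" by (simp add: euclidean_representation)
    also have "\<dots> = v \<bullet> (\<Sum>b\<in>Basis. h' b *\<^sub>R b)"
      by (simp add: sum scaleR inner_sum_right mult.commute)
    finally show ?thesis .
  qed
  then have "h' = (\<lambda>v. v \<bullet> (\<Sum>b\<in>Basis. h' b *\<^sub>R b))" by (rule ext)
  with h' have ex: "GDERIV h z :> (\<Sum>b\<in>Basis. h' b *\<^sub>R b)"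
    unfolding gderiv_def by (rule subst[rotated])
  have "D = E" if "GDERIV h z :> D" "GDERIV h z :> E" for D E
  proof -
    have "(\<lambda>v. v \<bullet> D) = (\<lambda>v. v \<bullet> E)"
      using that has_derivative_unique unfolding gderiv_def by blast
    then show ?thesis by (metis vector_eq_ldot)
  qed
  with ex show ?thesis unfolding gradient_def by (metis theI)
qed


section \<open>Stochastic orders\<close>

definition big_O_P :: "'w measure \<Rightarrow> (nat \<Rightarrow> 'w \<Rightarrow> ennreal) \<Rightarrow> (nat \<Rightarrow> real) \<Rightarrow> bool" where
  "big_O_P M Z a \<longleftrightarrow>
     (\<forall>n. Z n \<in> borel_measurable M) \<and>
     (\<forall>\<epsilon>>0. \<exists>A>0. \<forall>\<^sub>F n in sequentially.
        measure M {\<omega> \<in> space M. Z n \<omega> > ennreal (A * a n)} \<le> \<epsilon>)"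

definition small_o_P :: "'w measure \<Rightarrow> (nat \<Rightarrow> 'w \<Rightarrow> ennreal) \<Rightarrow> (nat \<Rightarrow> real) \<Rightarrow> bool" where
  "small_o_P M Z a \<longleftrightarrow>
     (\<forall>n. Z n \<in> borel_measurable M) \<and>
     (\<forall>\<epsilon>>0. (\<lambda>n. measure M {\<omega> \<in> space M. Z n \<omega> > ennreal (a n * \<epsilon>)}) \<longlonglongrightarrow> 0)"

text \<open>
  \<open>Z\<^sub>n = O\<^sub>P(a\<^sub>n) + o\<^sub>P(b\<^sub>n)\<close>. The dominating terms are genuine random variables; \<open>Z\<close> itself need
  not be measurable, as happens for suprema over uncountable classes.
\<close>

definition O_P_plus_o_P ::
    "'w measure \<Rightarrow> (nat \<Rightarrow> 'w \<Rightarrow> ennreal) \<Rightarrow> (nat \<Rightarrow> real) \<Rightarrow> (nat \<Rightarrow> real) \<Rightarrow> bool" where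
  "O_P_plus_o_P M Z a b \<longleftrightarrow>
     (\<exists>U V. big_O_P M U a \<and> small_o_P M V b \<and> (\<forall>n. \<forall>\<omega>\<in>space M. Z n \<omega> \<le> U n \<omega> + V n \<omega>))"

definition nn_sup_deviation ::
    "(nat \<Rightarrow> 'w \<Rightarrow> real ^ 'd) \<Rightarrow> (real ^ 'd \<Rightarrow> 's measure) \<Rightarrow> ('s \<Rightarrow> real) set \<Rightarrow> (nat \<Rightarrow> nat)
      \<Rightarrow> real ^ 'd \<Rightarrow> nat \<Rightarrow> 'w \<Rightarrow> ennreal" where
  "nn_sup_deviation X \<mu> \<G> k x n \<omega> =
     (SUP g\<in>\<G>. ennreal \<bar>(1 / real (k n)) *
        (\<Sum>i\<in>nearest_neighbors (\<lambda>i. X i \<omega>) n (k n) x.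
           (\<integral>s. g s \<partial>\<mu> (X i \<omega>)) - (\<integral>s. g s \<partial>\<mu> x))\<bar>)"

end

theory Submission
  imports Defs
begin

text \<open>
  The Lipschitz and gradient bounds reduce the supremum over the class to the geometry of the
  sample. Let \<open>r\<close> be the radius with \<open>f x\<close> times the volume of the ball equal to \<open>k/n\<close>, so
  that \<open>r\<close> is a constant times \<open>(k/n) powr (1/d)\<close>. By Chebyshev's inequality all \<open>k\<close> neighbours
  lie within \<open>4 r\<close> with probability tending to \<open>1\<close>, which gives (a). For (b), a first-order
  expansion leaves an error of order \<open>r\<^sup>2\<close> and the mean displacement \<open>1/k \<Sum> (X\<^sub>i - x)\<close> over the
  neighbours. Replacing the neighbours by the points in the ball of radius \<open>r\<close> changes as many
  terms as the number of those points differs from \<open>k\<close>. The ball average is a sum of independent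
  variables whose mean is small because \<open>z - x\<close> integrates to zero over the ball and \<open>f\<close> is
  Lipschitz; all fluctuations have standard deviation of order \<open>r k powr (-1/2)\<close>.
\<close>

section \<open>Nearest neighbours\<close>

lemma finite_nearest_neighbors [simp]: "finite (nearest_neighbors p n k x)"
  by (simp add: nearest_neighbors_def)

lemma nearest_neighbors_subset: "nearest_neighbors p n k x \<subseteq> {1..n}"
  by (auto simp: nearest_neighbors_def)

text \<open>The order by distance and then index is strict and total, so \<open>rank\<close> is
  strictly monotone along it. It therefore maps \<open>{1..n}\<close> bijectively onto
  \<open>{..<n}\<close>, and each rank below \<open>k\<close> is taken exactly once.\<close>

lemma card_nearest_neighbors:
  assumes "k \<le> n"
  shows "card (nearest_neighbors p n k x) = k"
proof -
  define P where "P j i \<longleftrightarrow> dist x (p j) < dist x (p i) \<or> dist x (p j) = dist x (p i) \<and> j < i" for i j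
  define rank where "rank i = card {j \<in> {1..n}. P j i}" for i
  have less: "rank i < rank j" if "P i j" "i \<in> {1..n}" for i j
    unfolding rank_def
  proof (rule psubset_card_mono)
    show "{l \<in> {1..n}. P l i} \<subset> {l \<in> {1..n}. P l j}"
      using that by (auto simp: P_def)
  qed simp
  have total: "P i j \<or> P j i" if "i \<noteq> j" for i j
    using that by (auto simp: P_def)
  have inj: "inj_on rank {1..n}"
    by (intro inj_onI) (metis less total less_irrefl)
  have "rank ` {1..n} \<subseteq> {..<n}"
  proof (intro image_subsetI)
    fix i assume i: "i \<in> {1..n}"
    have "rank i \<le> card ({1..n} - {i})"
      unfolding rank_def by (rule card_mono) (auto simp: P_def)
    then show "rank i \<in> {..<n}" using i by auto
  qed
  then have img: "rank ` {1..n} = {..<n}"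
    using card_image[OF inj] by (intro card_subset_eq) simp_all
  have eq: "nearest_neighbors p n k x = {i \<in> {1..n}. rank i < k}"
    by (simp add: nearest_neighbors_def rank_def P_def)
  have "rank ` {i \<in> {1..n}. rank i < k} = {..<k}"
  proof -
    have "rank ` {i \<in> {1..n}. rank i < k} = rank ` {1..n} \<inter> {..<k}" by auto
    also have "\<dots> = {..<k}" unfolding img using assms by auto
    finally show ?thesis .
  qed
  moreover have "inj_on rank {i \<in> {1..n}. rank i < k}"
    by (rule inj_on_subset[OF inj]) auto
  ultimately show ?thesis
    unfolding eq by (metis card_image card_lessThan)
qed

text \<open>If a neighbour lay outside the ball, all points of the ball, at least \<open>k\<close>
  of them, would precede it, and its rank could not be below \<open>k\<close>.\<close>

lemma nearest_neighbors_dist_le: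
  assumes "k \<le> card {j \<in> {1..n}. dist x (p j) \<le> r}" "i \<in> nearest_neighbors p n k x"
  shows "dist x (p i) \<le> r"
proof (rule ccontr)
  assume "\<not> dist x (p i) \<le> r"
  then have "card {j \<in> {1..n}. dist x (p j) \<le> r}
      \<le> card {j \<in> {1..n}. dist x (p j) < dist x (p i) \<or> dist x (p j) = dist x (p i) \<and> j < i}"
    by (intro card_mono) auto
  with assms show False by (simp add: nearest_neighbors_def)
qed

text \<open>Both sets are initial segments of the same total order, and two such segments are always
  comparable.\<close>

lemma nearest_neighbors_nested:
  fixes p n k x r
  defines "N \<equiv> nearest_neighbors p n k x" and "B \<equiv> {i \<in> {1..n}. dist x (p i) \<le> r}"
  shows "B \<subseteq> N \<or> N \<subseteq> B"
proof (rule ccontr)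
  assume "\<not> (B \<subseteq> N \<or> N \<subseteq> B)"
  then obtain i j where i: "i \<in> B" "i \<notin> N" and j: "j \<in> N" "j \<notin> B" by blast
  have "dist x (p i) < dist x (p j)"
    using i j nearest_neighbors_subset[of p n k x] by (auto simp: N_def B_def)
  then have "card {l \<in> {1..n}. dist x (p l) < dist x (p i) \<or> dist x (p l) = dist x (p i) \<and> l < i}
      \<le> card {l \<in> {1..n}. dist x (p l) < dist x (p j) \<or> dist x (p l) = dist x (p j) \<and> l < j}"
    by (intro card_mono) auto
  with i j show False
    by (auto simp: N_def B_def nearest_neighbors_def)
qed

text \<open>For nested sets the symmetric difference has as many elements as the cardinalities
  differ, so a bound on the counts alone controls the change in the sum.\<close>

lemma norm_sum_diff_nested_le:
  fixes v :: "'i \<Rightarrow> 'b::real_normed_vector"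
  assumes "finite A" "finite B" "A \<subseteq> B \<or> B \<subseteq> A" "\<And>i. i \<in> A \<union> B \<Longrightarrow> norm (v i) \<le> R"
  shows "norm (sum v A - sum v B) \<le> \<bar>real (card A) - real (card B)\<bar> * R"
proof -
  have *: "norm (sum v D - sum v C) \<le> \<bar>real (card D) - real (card C)\<bar> * R"
    if "C \<subseteq> D" "finite D" "\<And>i. i \<in> D \<Longrightarrow> norm (v i) \<le> R" for C D
  proof -
    have "sum v D - sum v C = sum v (D - C)"
      using that by (simp add: sum_diff)
    also have "norm \<dots> \<le> (\<Sum>i\<in>D - C. R)"
      using that by (intro sum_norm_le) auto
    also have "\<dots> = real (card (D - C)) * R" by simp
    also have "real (card (D - C)) = \<bar>real (card D) - real (card C)\<bar>"
      using that card_mono[of D C] by (simp add: card_Diff_subset finite_subset of_nat_diff)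
    finally show ?thesis .
  qed
  from assms(3) show ?thesis
  proof
    assume "A \<subseteq> B"
    with *[of A B] assms show ?thesis by (simp add: norm_minus_commute abs_minus_commute)
  next
    assume "B \<subseteq> A"
    with *[of B A] assms show ?thesis by simp
  qed
qed

section \<open>Gradients\<close>

text \<open>The difference quotient in the direction \<open>D\<close> of the gradient tends to the
  squared norm of \<open>D\<close>, while the Lipschitz bound at \<open>x\<close> keeps it below
  \<open>L * norm D\<close>. This gives one bound on the gradients at \<open>x\<close> for a whole
  class of functions.\<close>

lemma norm_gradient_le:
  fixes h :: "'a::euclidean_space \<Rightarrow> real"
  assumes "h differentiable at x" and "\<tau> > 0"
    and L: "\<And>z. z \<in> cball x \<tau> \<Longrightarrow> \<bar>h x - h z\<bar> \<le> L * norm (x - z)"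
  shows "norm (gradient h x) \<le> L"
proof (cases "gradient h x = 0")
  case True
  \<comment> \<open>With a zero gradient the claim is \<open>L \<ge> 0\<close>, which is not
    assumed; it follows from the Lipschitz bound at a point at distance
    \<open>\<tau>\<close>.\<close>
  obtain b :: 'a where b: "b \<in> Basis" using nonempty_Basis by blast
  have "0 \<le> \<bar>h x - h (x + \<tau> *\<^sub>R b)\<bar>" by simp
  also have "\<dots> \<le> L * norm (x - (x + \<tau> *\<^sub>R b))"
    using b \<open>\<tau> > 0\<close> by (intro L) (simp add: dist_norm)
  finally show ?thesis
    using b \<open>\<tau> > 0\<close> True by (simp add: zero_le_mult_iff)
next
  case False
  define D where "D = gradient h x"
  have "(h has_derivative (\<lambda>v. v \<bullet> D)) (at x)"
    using GDERIV_gradient[OF assms(1)] by (simp add: gderiv_def D_def)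
  \<comment> \<open>The point is written as the value at \<open>0\<close> of the line
    \<open>x + t D\<close>, the form in which the chain rule takes it.\<close>
  then have h: "(h has_derivative (\<lambda>v. v \<bullet> D)) (at (x + 0 *\<^sub>R D))" by simp
  have "((\<lambda>t. x + t *\<^sub>R D) has_derivative (\<lambda>t. t *\<^sub>R D)) (at 0)"
    by (auto intro!: derivative_eq_intros)
  from has_derivative_compose[OF this h]
  have "((\<lambda>t. h (x + t *\<^sub>R D)) has_derivative (\<lambda>t. (t *\<^sub>R D) \<bullet> D)) (at 0)" .
  then have "((\<lambda>t. h (x + t *\<^sub>R D)) has_real_derivative (D \<bullet> D)) (at 0)"
    by (rule has_derivative_imp_has_field_derivative) simp
  then have "((\<lambda>t. (h (x + t *\<^sub>R D) - h x) / t) \<longlongrightarrow> D \<bullet> D) (at 0)"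
    by (simp add: has_field_derivative_iff)
  moreover have "\<forall>\<^sub>F t in at 0. (h (x + t *\<^sub>R D) - h x) / t \<le> L * norm D"
  proof -
    have "D \<noteq> 0" using False by (simp add: D_def)
    show ?thesis
      unfolding eventually_at
    proof (intro exI[of _ "\<tau> / norm D"] conjI ballI impI)
      show "\<tau> / norm D > 0" using \<open>\<tau> > 0\<close> \<open>D \<noteq> 0\<close> by simp
      fix t :: real assume t: "t \<noteq> 0 \<and> dist t 0 < \<tau> / norm D"
      then have "x + t *\<^sub>R D \<in> cball x \<tau>"
        using \<open>D \<noteq> 0\<close> by (simp add: dist_norm field_simps)
      from L[OF this] have "\<bar>h (x + t *\<^sub>R D) - h x\<bar> \<le> L * norm D * \<bar>t\<bar>"
        by (simp add: abs_minus_commute mult_ac)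
      moreover have "(h (x + t *\<^sub>R D) - h x) / t \<le> \<bar>h (x + t *\<^sub>R D) - h x\<bar> / \<bar>t\<bar>"
        by (metis abs_divide abs_ge_self)
      moreover have "\<bar>h (x + t *\<^sub>R D) - h x\<bar> / \<bar>t\<bar> \<le> L * norm D"
        using calculation(1) t by (simp add: divide_le_eq)
      ultimately show "(h (x + t *\<^sub>R D) - h x) / t \<le> L * norm D" by linarith
    qed
  qed
  ultimately have "D \<bullet> D \<le> L * norm D"
    by (rule tendsto_upperbound) simp
  then show ?thesis
    using False by (simp add: dot_square_norm power2_eq_square D_def)
qed

text \<open>This is the mean value inequality for \<open>h\<close> minus its linear part at
  \<open>x\<close>. The constant is not the optimal \<open>L / 2\<close>, but only the quadratic
  order matters.\<close>

lemma gradient_linearization_bound: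
  fixes h :: "'a::euclidean_space \<Rightarrow> real"
  assumes h: "\<And>z. z \<in> cball x \<tau> \<Longrightarrow> h differentiable (at z)"
    and L: "\<And>z. z \<in> cball x \<tau> \<Longrightarrow> norm (gradient h x - gradient h z) \<le> L * norm (x - z)"
    and "L \<ge> 0" and z: "z \<in> cball x \<tau>"
  shows "\<bar>h z - h x - (z - x) \<bullet> gradient h x\<bar> \<le> L * (norm (z - x))\<^sup>2"
proof -
  \<comment> \<open>On this ball, rather than the one of radius \<open>\<tau>\<close>, the gradient
    varies by at most \<open>L * norm (z - x)\<close>; that is the source of the second factor
    \<open>norm (z - x)\<close>.\<close>
  let ?S = "cball x (norm (z - x))"
  have sub: "?S \<subseteq> cball x \<tau>" using z by (auto simp: dist_norm norm_minus_commute)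
  have "norm (h z - h x - (\<lambda>w v. v \<bullet> gradient h w) x (z - x)) \<le> norm (z - x) * (L * norm (z - x))"
  proof (rule differentiable_bound_linearization[of x z ?S h
        "\<lambda>w v. v \<bullet> gradient h w" x "L * norm (z - x)"])
    fix t :: real assume "t \<in> {0..1}"
    then show "x + t *\<^sub>R (z - x) \<in> ?S"
      by (auto simp: dist_norm intro!: mult_left_le_one_le)
  next
    fix w assume w: "w \<in> ?S"
    show "(h has_derivative (\<lambda>v. v \<bullet> gradient h w)) (at w within ?S)"
      using GDERIV_gradient[OF h] w sub unfolding gderiv_def
      by (blast intro: has_derivative_at_withinI)
    show "onorm ((\<lambda>v. v \<bullet> gradient h w) - (\<lambda>v. v \<bullet> gradient h x)) \<le> L * norm (z - x)"
    proof (rule onorm_le)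
      fix v
      have "norm (((\<lambda>v. v \<bullet> gradient h w) - (\<lambda>v. v \<bullet> gradient h x)) v)
          = \<bar>v \<bullet> (gradient h w - gradient h x)\<bar>"
        by (simp add: inner_diff_right)
      also have "\<dots> \<le> norm v * norm (gradient h w - gradient h x)"
        by (rule Cauchy_Schwarz_ineq2)
      also have "\<dots> \<le> norm v * (L * norm (z - x))"
      proof (rule mult_left_mono)
        have "norm (gradient h w - gradient h x) \<le> L * norm (x - w)"
          using L[of w] w sub by (auto simp: norm_minus_commute)
        also have "\<dots> \<le> L * norm (z - x)"
          using w \<open>L \<ge> 0\<close> by (intro mult_left_mono) (auto simp: dist_norm)
        finally show "norm (gradient h w - gradient h x) \<le> L * norm (z - x)" .
      qed simp
      finally show "norm (((\<lambda>v. v \<bullet> gradient h w) - (\<lambda>v. v \<bullet> gradient h x)) v)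
          \<le> L * norm (z - x) * norm v"
        by (simp add: mult.commute)
    qed
  qed simp
  then show ?thesis by (simp add: power2_eq_square mult_ac)
qed

section \<open>Stochastic orders\<close>

lemma small_o_P_0: "small_o_P M (\<lambda>_ _. 0) b"
  by (simp add: small_o_P_def)

lemma small_o_P_add:
  assumes "finite_measure M" and U: "small_o_P M U b" and V: "small_o_P M V b"
  shows "small_o_P M (\<lambda>n \<omega>. U n \<omega> + V n \<omega>) b"
proof -
  interpret finite_measure M by fact
  have [measurable]: "U n \<in> borel_measurable M" "V n \<in> borel_measurable M" for n
    using U V by (auto simp: small_o_P_def)
  let ?P = "\<lambda>Z n \<epsilon>. {\<omega> \<in> space M. Z n \<omega> > ennreal (b n * \<epsilon>)}"
  have le: "measure M (?P (\<lambda>n \<omega>. U n \<omega> + V n \<omega>) n \<epsilon>)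
      \<le> measure M (?P U n (\<epsilon> / 2)) + measure M (?P V n (\<epsilon> / 2))" if "\<epsilon> > 0" for n \<epsilon>
  proof -
    have "U n \<omega> + V n \<omega> \<le> ennreal (b n * \<epsilon>)"
      if "U n \<omega> \<le> ennreal (b n * (\<epsilon> / 2))" "V n \<omega> \<le> ennreal (b n * (\<epsilon> / 2))" for \<omega>
    proof (cases "b n \<ge> 0")
      case True
      have "U n \<omega> + V n \<omega> \<le> ennreal (b n * (\<epsilon> / 2)) + ennreal (b n * (\<epsilon> / 2))"
        using that by (rule add_mono)
      also have "\<dots> = ennreal (b n * \<epsilon>)"
        using True \<open>\<epsilon> > 0\<close> by (simp flip: ennreal_plus)
      finally show ?thesis .
    next
      \<comment> \<open>A negative threshold is truncated to \<open>0\<close> by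
        \<open>ennreal\<close>, so both summands vanish.\<close>
      case False
      then have "b n * (\<epsilon> / 2) \<le> 0"
        using \<open>\<epsilon> > 0\<close> by (intro mult_nonpos_nonneg) auto
      with that show ?thesis by (simp add: ennreal_neg)
    qed
    then have "?P (\<lambda>n \<omega>. U n \<omega> + V n \<omega>) n \<epsilon> \<subseteq> ?P U n (\<epsilon> / 2) \<union> ?P V n (\<epsilon> / 2)"
      by (force simp flip: not_le)
    then have "measure M (?P (\<lambda>n \<omega>. U n \<omega> + V n \<omega>) n \<epsilon>)
        \<le> measure M (?P U n (\<epsilon> / 2) \<union> ?P V n (\<epsilon> / 2))"
      by (rule finite_measure_mono) measurable
    also have "\<dots> \<le> measure M (?P U n (\<epsilon> / 2)) + measure M (?P V n (\<epsilon> / 2))"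
      by (rule measure_Un_le) measurable
    finally show ?thesis .
  qed
  show ?thesis
    unfolding small_o_P_def
  proof (intro conjI allI impI)
    show "(\<lambda>\<omega>. U n \<omega> + V n \<omega>) \<in> borel_measurable M" for n by measurable
    fix \<epsilon> :: real assume "\<epsilon> > 0"
    then have "(\<lambda>n. measure M (?P U n (\<epsilon> / 2))) \<longlonglongrightarrow> 0" "(\<lambda>n. measure M (?P V n (\<epsilon> / 2))) \<longlonglongrightarrow> 0"
      using U V unfolding small_o_P_def by (auto dest!: spec[of _ "\<epsilon> / 2"])
    from tendsto_add[OF this]
    have lim: "(\<lambda>n. measure M (?P U n (\<epsilon> / 2)) + measure M (?P V n (\<epsilon> / 2))) \<longlonglongrightarrow> 0" by simp
    show "(\<lambda>n. measure M (?P (\<lambda>n \<omega>. U n \<omega> + V n \<omega>) n \<epsilon>)) \<longlonglongrightarrow> 0"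
      by (rule tendsto_sandwich[OF _ _ tendsto_const lim])
         (use le[OF \<open>\<epsilon> > 0\<close>] in auto)
  qed
qed

lemma small_o_P_sum:
  assumes "finite_measure M" "finite J" "\<And>j. j \<in> J \<Longrightarrow> small_o_P M (V j) b"
  shows "small_o_P M (\<lambda>n \<omega>. \<Sum>j\<in>J. V j n \<omega>) b"
  using assms(2,3)
proof (induction J)
  case empty
  show ?case by (simp add: small_o_P_0)
next
  case (insert j J)
  then have "small_o_P M (V j) b" "small_o_P M (\<lambda>n \<omega>. \<Sum>j\<in>J. V j n \<omega>) b" by blast+
  from small_o_P_add[OF assms(1) this] insert.hyps show ?case by simp
qed

text \<open>Every threshold is finite, so it is exceeded exactly off \<open>E n\<close>, whatever
  the rate. Exceptional events of vanishing probability can thus be absorbed into the small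
  term.\<close>

lemma small_o_P_top_off_likely_event:
  assumes "prob_space M" and E [measurable]: "\<And>n. E n \<in> sets M"
    and lim: "(\<lambda>n. measure M (E n)) \<longlonglongrightarrow> 1"
  shows "small_o_P M (\<lambda>n \<omega>. if \<omega> \<in> E n then 0 else \<top>) b"
proof -
  interpret prob_space M by fact
  have "(\<lambda>n. measure M (space M - E n)) \<longlonglongrightarrow> 0"
    using tendsto_diff[OF tendsto_const[of 1] lim] by (simp add: prob_compl)
  moreover have "{\<omega> \<in> space M. (if \<omega> \<in> E n then 0 else \<top> :: ennreal) > ennreal c} = space M - E n" for n c
    by (auto simp: less_top)
  ultimately show ?thesis
    unfolding small_o_P_def by simp
qed

text \<open>Chebyshev's inequality at the level \<open>b n * \<epsilon>\<close>. Positivity of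
  \<open>b\<close> is asked only eventually because the rate involving \<open>k n\<close> is
  controlled from \<open>n = 1\<close> on.\<close>

lemma small_o_P_second_moment:
  fixes W :: "nat \<Rightarrow> 'w \<Rightarrow> real"
  assumes "finite_measure M" and W [measurable]: "\<And>n. W n \<in> borel_measurable M"
    and int: "\<And>n. integrable M (\<lambda>\<omega>. (W n \<omega>)\<^sup>2)"
    and b: "\<forall>\<^sub>F n in sequentially. b n > 0"
    and lim: "(\<lambda>n. (\<integral>\<omega>. (W n \<omega>)\<^sup>2 \<partial>M) / (b n)\<^sup>2) \<longlonglongrightarrow> 0"
  shows "small_o_P M (\<lambda>n \<omega>. ennreal \<bar>W n \<omega>\<bar>) b"
  unfolding small_o_P_def
proof (intro conjI allI impI)
  interpret finite_measure M by fact
  show "(\<lambda>\<omega>. ennreal \<bar>W n \<omega>\<bar>) \<in> borel_measurable M" for n by measurable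
  fix \<epsilon> :: real assume "\<epsilon> > 0"
  have le: "\<forall>\<^sub>F n in sequentially. measure M {\<omega> \<in> space M. ennreal \<bar>W n \<omega>\<bar> > ennreal (b n * \<epsilon>)}
      \<le> (\<integral>\<omega>. (W n \<omega>)\<^sup>2 \<partial>M) / (b n)\<^sup>2 / \<epsilon>\<^sup>2"
    using b
  proof eventually_elim
    case (elim n)
    have "measure M {\<omega> \<in> space M. ennreal \<bar>W n \<omega>\<bar> > ennreal (b n * \<epsilon>)}
        \<le> measure M {\<omega> \<in> space M. \<bar>W n \<omega>\<bar> \<ge> b n * \<epsilon>}"
      using elim \<open>\<epsilon> > 0\<close> by (intro finite_measure_mono) (auto simp: ennreal_less_iff)
    also have "\<dots> \<le> (\<integral>\<omega>. (W n \<omega>)\<^sup>2 \<partial>M) / (b n * \<epsilon>)\<^sup>2"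
      using elim \<open>\<epsilon> > 0\<close> int by (intro second_moment_method) auto
    finally show ?case by (simp add: power_mult_distrib)
  qed
  have lim0: "(\<lambda>n. (\<integral>\<omega>. (W n \<omega>)\<^sup>2 \<partial>M) / (b n)\<^sup>2 / \<epsilon>\<^sup>2) \<longlonglongrightarrow> 0"
    using tendsto_divide[OF lim tendsto_const[of "\<epsilon>\<^sup>2"]] \<open>\<epsilon> > 0\<close> by simp
  show "(\<lambda>n. measure M {\<omega> \<in> space M. ennreal \<bar>W n \<omega>\<bar> > ennreal (b n * \<epsilon>)}) \<longlonglongrightarrow> 0"
    by (rule tendsto_sandwich[OF _ le tendsto_const lim0]) simp
qed

text \<open>The large term can be the constant \<open>K * a n\<close>. Off the likely events a
  summand \<open>\<top>\<close> is added to \<open>V\<close>, which makes the domination hold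
  everywhere and keeps the sum of small order.\<close>

lemma O_P_plus_o_P_on_likely_events:
  fixes a b :: "nat \<Rightarrow> real"
  assumes M: "prob_space M" and E: "\<And>n. E n \<in> sets M"
    and lim: "(\<lambda>n. measure M (E n)) \<longlonglongrightarrow> 1"
    and V: "small_o_P M V b" and "K > 0"
    and le: "\<forall>\<^sub>F n in sequentially. \<forall>\<omega>\<in>E n. Z n \<omega> \<le> ennreal (K * a n) + V n \<omega>"
  shows "O_P_plus_o_P M Z a b"
proof -
  from le obtain n0 where n0: "\<And>n \<omega>. n \<ge> n0 \<Longrightarrow> \<omega> \<in> E n \<Longrightarrow> Z n \<omega> \<le> ennreal (K * a n) + V n \<omega>"
    by (auto simp: eventually_sequentially)
  \<comment> \<open>The domination is required for every \<open>n\<close>. Emptying the finitely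
    many events before \<open>n0\<close> lets the value \<open>\<top>\<close> cover those
    indices.\<close>
  define E' where "E' n = (if n \<ge> n0 then E n else {})" for n
  have "\<forall>\<^sub>F n in sequentially. measure M (E n) = measure M (E' n)"
    by (auto simp: E'_def eventually_sequentially)
  with lim have "(\<lambda>n. measure M (E' n)) \<longlonglongrightarrow> 1"
    by (rule Lim_transform_eventually)
  then have "small_o_P M (\<lambda>n \<omega>. if \<omega> \<in> E' n then 0 else \<top>) b"
    using E by (intro small_o_P_top_off_likely_event M) (auto simp: E'_def)
  with V have "small_o_P M (\<lambda>n \<omega>. V n \<omega> + (if \<omega> \<in> E' n then 0 else \<top>)) b"
    using M by (intro small_o_P_add) (auto simp: prob_space_def)
  moreover have "big_O_P M (\<lambda>n _. ennreal (K * a n)) a"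
    using \<open>K > 0\<close> unfolding big_O_P_def by (auto intro!: exI[of _ K])
  moreover have "Z n \<omega> \<le> ennreal (K * a n) + (V n \<omega> + (if \<omega> \<in> E' n then 0 else \<top>))" for n \<omega>
    using n0[of n \<omega>] by (auto simp: E'_def)
  ultimately show ?thesis
    unfolding O_P_plus_o_P_def by blast
qed

section \<open>Sums of independent random variables\<close>

text \<open>Independence removes the cross terms of the expanded square; boundedness of
  \<open>h\<close> supplies all the integrability.\<close>

lemma (in prob_space) second_moment_sum_le:
  fixes Xs :: "'i \<Rightarrow> 'a \<Rightarrow> 'b" and h :: "'b \<Rightarrow> real"
  assumes indep: "indep_vars (\<lambda>_. N) Xs I" and I: "finite I"
    and D: "\<And>i. i \<in> I \<Longrightarrow> distr M N (Xs i) = D"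
    and h: "h \<in> borel_measurable N" and bounded: "\<And>z. \<bar>h z\<bar> \<le> B"
  defines "T \<equiv> \<lambda>\<omega>. \<Sum>i\<in>I. h (Xs i \<omega>) - (\<integral>z. h z \<partial>D)"
  shows "integrable M (\<lambda>\<omega>. (T \<omega>)\<^sup>2)"
    and "expectation (\<lambda>\<omega>. (T \<omega>)\<^sup>2) \<le> real (card I) * (\<integral>z. (h z)\<^sup>2 \<partial>D)"
proof -
  define m where "m = (\<integral>z. h z \<partial>D)"
  define Z where "Z i \<omega> = h (Xs i \<omega>) - m" for i \<omega>
  have Xs [measurable]: "Xs i \<in> M \<rightarrow>\<^sub>M N" if "i \<in> I" for i
    using indep that by (auto simp: indep_vars_def)
  have Z [measurable]: "Z i \<in> borel_measurable M" if "i \<in> I" for i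
    using that h unfolding Z_def by measurable
  have Z_bounded: "\<bar>Z i \<omega>\<bar> \<le> B + \<bar>m\<bar>" for i \<omega>
    using bounded[of "Xs i \<omega>"] by (auto simp: Z_def)
  have int_h: "integrable M (\<lambda>\<omega>. h (Xs i \<omega>))" if "i \<in> I" for i
    using that h bounded by (intro integrable_const_bound[of _ B]) auto
  have int_Z: "integrable M (Z i)" if "i \<in> I" for i
    using int_h[OF that] unfolding Z_def by simp
  have int_ZZ: "integrable M (\<lambda>\<omega>. Z i \<omega> * Z j \<omega>)" if "i \<in> I" "j \<in> I" for i j
  proof (rule integrable_const_bound[of _ "(B + \<bar>m\<bar>) * (B + \<bar>m\<bar>)"])
    show "AE \<omega> in M. norm (Z i \<omega> * Z j \<omega>) \<le> (B + \<bar>m\<bar>) * (B + \<bar>m\<bar>)"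
      by (intro AE_I2) (auto simp: abs_mult intro!: mult_mono Z_bounded order_trans[OF abs_ge_zero Z_bounded])
  qed (use that in measurable)
  have E_h: "expectation (\<lambda>\<omega>. g (Xs i \<omega>)) = (\<integral>z. g z \<partial>D)"
    if "i \<in> I" "g \<in> borel_measurable N" for i and g :: "'b \<Rightarrow> real"
    using that D[of i] by (metis Xs integral_distr)
  have E_Z: "expectation (Z i) = 0" if "i \<in> I" for i
    using int_h[OF that] E_h[OF that h] by (simp add: Z_def[abs_def] m_def prob_space)
  have indep_Z: "indep_vars (\<lambda>_. borel) Z I"
    unfolding Z_def
    by (rule indep_vars_compose2[OF indep, of "\<lambda>_ z. h z - m"]) (use h in simp)
  have E_ZZ: "expectation (\<lambda>\<omega>. Z i \<omega> * Z j \<omega>) = 0" if "i \<in> I" "j \<in> I" "i \<noteq> j" for i j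
  proof -
    have "expectation (\<lambda>\<omega>. \<Prod>l\<in>{i, j}. Z l \<omega>) = (\<Prod>l\<in>{i, j}. expectation (Z l))"
      using that by (intro indep_vars_lebesgue_integral indep_vars_subset[OF indep_Z] int_Z) auto
    with that show ?thesis by (simp add: E_Z)
  qed
  \<comment> \<open>The variance is bounded by the uncentered second moment, which for functions
    supported in a ball is governed by the probability of that ball.\<close>
  have E_Z2: "expectation (\<lambda>\<omega>. Z i \<omega> * Z i \<omega>) \<le> (\<integral>z. (h z)\<^sup>2 \<partial>D)" if "i \<in> I" for i
  proof -
    have "integrable M (\<lambda>\<omega>. (h (Xs i \<omega>))\<^sup>2)"
    proof (rule integrable_const_bound[of _ "B\<^sup>2"])
      show "AE \<omega> in M. norm ((h (Xs i \<omega>))\<^sup>2) \<le> B\<^sup>2"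
        using bounded by (intro AE_I2) (simp add: abs_le_square_iff[symmetric] order_trans[OF bounded abs_ge_self])
    qed (use that h in measurable)
    then have "variance (\<lambda>\<omega>. h (Xs i \<omega>)) \<le> expectation (\<lambda>\<omega>. (h (Xs i \<omega>))\<^sup>2)"
      using int_h[OF that] by (subst variance_eq) auto
    moreover have "expectation (\<lambda>\<omega>. (h (Xs i \<omega>))\<^sup>2) = (\<integral>z. (h z)\<^sup>2 \<partial>D)"
      using that h by (intro E_h) auto
    ultimately show ?thesis
      using E_h[OF that h] by (simp add: Z_def m_def power2_eq_square)
  qed
  have T: "(T \<omega>)\<^sup>2 = (\<Sum>i\<in>I. \<Sum>j\<in>I. Z i \<omega> * Z j \<omega>)" for \<omega>
    by (simp add: T_def Z_def m_def power2_eq_square sum_product)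
  show "integrable M (\<lambda>\<omega>. (T \<omega>)\<^sup>2)"
    unfolding T by (intro Bochner_Integration.integrable_sum int_ZZ)
  have "expectation (\<lambda>\<omega>. (T \<omega>)\<^sup>2) = (\<Sum>i\<in>I. \<Sum>j\<in>I. expectation (\<lambda>\<omega>. Z i \<omega> * Z j \<omega>))"
    unfolding T by (simp add: int_ZZ Bochner_Integration.integral_sum)
  also have "\<dots> = (\<Sum>i\<in>I. \<Sum>j\<in>I. if j = i then expectation (\<lambda>\<omega>. Z i \<omega> * Z i \<omega>) else 0)"
    by (intro sum.cong refl) (auto simp: E_ZZ)
  also have "\<dots> = (\<Sum>i\<in>I. expectation (\<lambda>\<omega>. Z i \<omega> * Z i \<omega>))"
    using I by simp
  also have "\<dots> \<le> (\<Sum>i\<in>I. \<integral>z. (h z)\<^sup>2 \<partial>D)"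
    by (intro sum_mono E_Z2)
  finally show "expectation (\<lambda>\<omega>. (T \<omega>)\<^sup>2) \<le> real (card I) * (\<integral>z. (h z)\<^sup>2 \<partial>D)"
    by simp
qed

section \<open>Densities on balls\<close>

text \<open>Reflection through \<open>x\<close> preserves Lebesgue measure and the ball and reverses
  \<open>z - x\<close>, so the integral equals its own negative.\<close>

lemma integral_cball_symmetric:
  "(\<integral>z. indicator (cball x r) z *\<^sub>R (z - x) \<partial>lborel) = (0 :: 'a::euclidean_space)"
proof -
  have [measurable]: "cball x r \<in> sets borel" by simp
  let ?g = "\<lambda>z :: 'a. indicator (cball x r) z *\<^sub>R (z - x)"
  \<comment> \<open>The reflection is the affine map with factor \<open>-1\<close>, whose Jacobian
    has absolute value \<open>1\<close>.\<close>
  have refl: "distr lborel borel (\<lambda>z. 2 *\<^sub>R x - z) = lborel"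
    by (rule trans[OF _ lborel_affine[of "-1" "2 *\<^sub>R x", symmetric]]) (simp_all add: density_1)
  have "(\<integral>z. ?g z \<partial>lborel) = (\<integral>z. ?g z \<partial>distr lborel borel (\<lambda>z. 2 *\<^sub>R x - z))"
    by (simp only: refl)
  also have "\<dots> = (\<integral>z. ?g (2 *\<^sub>R x - z) \<partial>lborel)"
    by (rule integral_distr) measurable
  also have "\<dots> = (\<integral>z. - ?g z \<partial>lborel)"
    by (intro Bochner_Integration.integral_cong refl)
       (auto simp: dist_norm norm_minus_commute algebra_simps scaleR_2 split: split_indicator)
  also have "\<dots> = - (\<integral>z. ?g z \<partial>lborel)" by simp
  finally have "2 *\<^sub>R (\<integral>z. ?g z \<partial>lborel) = 0"
    by (simp add: scaleR_2 eq_neg_iff_add_eq_0)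
  then show ?thesis by simp
qed

text \<open>Freezing the density at the constant \<open>a\<close> costs at most \<open>e * B\<close>
  per unit of volume. It serves with \<open>g = 1\<close> for ball probabilities and with
  \<open>g z = z - x\<close> for the mean displacement.\<close>

lemma integral_density_cball_approx:
  fixes f :: "'a::euclidean_space \<Rightarrow> real" and g :: "'a \<Rightarrow> 'b::{banach, second_countable_topology}"
  assumes [measurable]: "f \<in> borel_measurable borel" and f_nonneg: "\<And>z. f z \<ge> 0"
    and g [measurable]: "g \<in> borel_measurable borel" and g_le: "\<And>z. z \<in> cball x r \<Longrightarrow> norm (g z) \<le> B"
    and f: "\<And>z. z \<in> cball x r \<Longrightarrow> \<bar>f z - a\<bar> \<le> e"
  shows "norm ((\<integral>z. indicator (cball x r) z *\<^sub>R g z \<partial>density lborel f)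
        - a *\<^sub>R (\<integral>z. indicator (cball x r) z *\<^sub>R g z \<partial>lborel))
      \<le> e * B * measure lborel (cball x r)"
\<comment> \<open>A negative radius gives an empty ball and two zero integrals; otherwise
  \<open>x\<close> lies in the ball and forces \<open>e \<ge> 0\<close>.\<close>
proof (cases "r \<ge> 0")
  case True
  then have "x \<in> cball x r" by simp
  have "e \<ge> 0" using order_trans[OF abs_ge_zero f[OF \<open>x \<in> cball x r\<close>]] .
  let ?B = "cball x r"
  have [measurable]: "?B \<in> sets borel" by simp
  have fin: "emeasure lborel ?B < \<infinity>"
    using emeasure_bounded_finite[of ?B] by (simp add: less_top)
  have int: "integrable lborel (\<lambda>z. indicator ?B z *\<^sub>R v z)"
    if "v \<in> borel_measurable borel" "\<And>z. z \<in> ?B \<Longrightarrow> norm (v z) \<le> C"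
    for v :: "'a \<Rightarrow> 'b" and C
    using that fin by (intro integrableI_bounded_set_indicator[where B = C]) auto
  have "(\<integral>z. indicator ?B z *\<^sub>R g z \<partial>density lborel f)
      = (\<integral>z. f z *\<^sub>R indicator ?B z *\<^sub>R g z \<partial>lborel)"
    by (rule integral_density) (use f_nonneg in auto)
  also have "\<dots> = (\<integral>z. indicator ?B z *\<^sub>R f z *\<^sub>R g z \<partial>lborel)"
    by (simp add: mult.commute)
  finally have "(\<integral>z. indicator ?B z *\<^sub>R g z \<partial>density lborel f)
        - a *\<^sub>R (\<integral>z. indicator ?B z *\<^sub>R g z \<partial>lborel)
      = (\<integral>z. indicator ?B z *\<^sub>R f z *\<^sub>R g z \<partial>lborel) - (\<integral>z. indicator ?B z *\<^sub>R a *\<^sub>R g z \<partial>lborel)"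
    by (simp flip: integral_scaleR_right add: mult.commute)
  also have "\<dots> = (\<integral>z. indicator ?B z *\<^sub>R (f z - a) *\<^sub>R g z \<partial>lborel)"
  proof (subst Bochner_Integration.integral_diff[symmetric])
    show "integrable lborel (\<lambda>z. indicator ?B z *\<^sub>R f z *\<^sub>R g z)"
    proof (rule int)
      fix z assume z: "z \<in> ?B"
      have "\<bar>f z\<bar> \<le> \<bar>a\<bar> + e" using f[OF z] by linarith
      then show "norm (f z *\<^sub>R g z) \<le> (\<bar>a\<bar> + e) * B"
        using g_le[OF z] \<open>e \<ge> 0\<close> by (auto intro!: mult_mono)
    qed measurable
    show "integrable lborel (\<lambda>z. indicator ?B z *\<^sub>R a *\<^sub>R g z)"
      by (rule int[of _ "\<bar>a\<bar> * B"]) (auto intro!: mult_left_mono g_le)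
  qed (simp add: algebra_simps)
  also have "norm \<dots> \<le> (\<integral>z. indicator ?B z *\<^sub>R (e * B) \<partial>lborel)"
  proof (rule Bochner_Integration.integral_norm_bound_integral)
    show "integrable lborel (\<lambda>z. indicator ?B z *\<^sub>R (f z - a) *\<^sub>R g z)"
      by (rule int[of _ "e * B"]) (auto intro!: mult_mono f g_le \<open>e \<ge> 0\<close>)
    show "integrable lborel (\<lambda>z. indicator ?B z *\<^sub>R (e * B))"
      using fin by (intro integrable_scaleR_left) auto
    show "norm (indicator ?B z *\<^sub>R (f z - a) *\<^sub>R g z) \<le> indicator ?B z *\<^sub>R (e * B)" for z
      by (cases "z \<in> ?B") (auto intro!: mult_mono f g_le \<open>e \<ge> 0\<close> simp del: mem_cball)
  qed
  finally show ?thesis by (simp add: mult_ac)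
qed simp

section \<open>The neighbours in a sample with a density\<close>

text \<open>The deviation is a function of the \<open>X\<close> part of the sample, so the
  probabilistic work is done for points with a density in any Euclidean space.\<close>

locale iid_density_sample = prob_space M
  for M :: "'w measure" +
  fixes Xs :: "nat \<Rightarrow> 'w \<Rightarrow> 'a::euclidean_space" and f :: "'a \<Rightarrow> real" and x :: 'a
    and k :: "nat \<Rightarrow> nat"
  assumes indep: "indep_vars (\<lambda>_. borel) Xs {1..}"
    and distr_Xs: "\<And>i. i \<ge> 1 \<Longrightarrow> distr M borel (Xs i) = density lborel f"
    and f_measurable [measurable]: "f \<in> borel_measurable borel"
    and f_nonneg: "\<And>z. f z \<ge> 0"
    and f_cont: "isCont f x" and f_pos: "f x > 0"
    and k_range: "\<And>n. n \<ge> 1 \<Longrightarrow> 1 \<le> k n \<and> k n \<le> n"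
    and k_inf: "filterlim k at_top sequentially"
    and k_n: "(\<lambda>n. real (k n) / real n) \<longlonglongrightarrow> 0"
begin

abbreviation "D \<equiv> density lborel (\<lambda>z. ennreal (f z))"

text \<open>The radius at which a ball around \<open>x\<close> would have probability \<open>k/n\<close> if the density were
  constantly \<open>f x\<close>.\<close>

definition radius :: "nat \<Rightarrow> real" where
  "radius n = (real (k n) / real n / (f x * measure lborel (cball (0::'a) 1))) powr (1 / real DIM('a))"

text \<open>The factor \<open>4\<close> leaves room for two losses: with constant density the ball
  would have probability at least \<open>4 k/n\<close>, the variation of \<open>f\<close> halves
  this at worst, and the fluctuation of the count may use up another half.\<close>

definition likely :: "nat \<Rightarrow> 'w set" where
  "likely n = {\<omega> \<in> space M. k n \<le> card {i \<in> {1..n}. dist x (Xs i \<omega>) \<le> 4 * radius n}}"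

definition centered_sum :: "('a \<Rightarrow> real) \<Rightarrow> nat \<Rightarrow> 'w \<Rightarrow> real" where
  "centered_sum h n \<omega> = (\<Sum>i\<in>{1..n}. h (Xs i \<omega>) - (\<integral>z. h z \<partial>D))"

lemma Xs_measurable: "i \<ge> 1 \<Longrightarrow> Xs i \<in> borel_measurable M"
  using indep by (auto simp: indep_vars_def)

sublocale D: prob_space D
  using prob_space_distr[OF Xs_measurable[of 1]] distr_Xs[of 1] by simp

lemma volume_pos: "measure lborel (cball (0::'a) 1) > 0"
  by simp

lemma radius_nonneg [simp]: "radius n \<ge> 0"
  by (simp add: radius_def)

lemma radius_power:
  "radius n ^ DIM('a) = real (k n) / real n / (f x * measure lborel (cball (0::'a) 1))"
proof -
  define y where "y = real (k n) / real n / (f x * measure lborel (cball (0::'a) 1))"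
  have "y \<ge> 0" using f_pos by (simp add: y_def)
  \<comment> \<open>The case \<open>y = 0\<close> arises at \<open>n = 0\<close>, where division by
    zero yields \<open>0\<close>.\<close>
  then have "(y powr (1 / real DIM('a))) ^ DIM('a) = y"
    by (cases "y = 0") (simp_all add: powr_realpow[symmetric] powr_powr)
  then show ?thesis
    unfolding radius_def y_def .
qed

lemma volume_cball:
  assumes "c \<ge> 0"
  shows "f x * measure lborel (cball x (c * radius n)) = c ^ DIM('a) * (real (k n) / real n)"
proof -
  have "unit_ball_vol (real DIM('a)) \<noteq> 0"
    using unit_ball_vol_pos[of "real DIM('a)"] by linarith
  then show ?thesis
    using assms f_pos radius_power[of n] radius_nonneg[of n]
    by (simp add: content_cball power_mult_distrib)
qed

lemma radius_tendsto_0: "radius \<longlonglongrightarrow> 0"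
proof -
  have "(\<lambda>n. real (k n) / real n / (f x * measure lborel (cball (0::'a) 1))) \<longlonglongrightarrow> 0"
    using tendsto_divide[OF k_n tendsto_const] f_pos volume_pos by fastforce
  then show ?thesis
    unfolding radius_def[abs_def] by (rule tendsto_zero_powrI[OF _ tendsto_const]) (use f_pos in auto)
qed

lemma eventually_radius_less: "\<rho> > 0 \<Longrightarrow> \<forall>\<^sub>F n in sequentially. c * radius n < \<rho>"
  using order_tendstoD(2)[OF tendsto_mult_right_zero[OF radius_tendsto_0]] .

text \<open>Continuity at \<open>x\<close> and shrinking radii suffice. The tolerance
  \<open>f x / 2\<close> keeps ball probabilities between \<open>1/2\<close> and \<open>3/2\<close>
  of their values under constant density.\<close>

lemma eventually_density_close:
  assumes "c \<ge> 0"
  shows "\<forall>\<^sub>F n in sequentially. \<forall>z\<in>cball x (c * radius n). \<bar>f z - f x\<bar> \<le> f x / 2"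
proof -
  have "f x / 2 > 0" using f_pos by simp
  then obtain \<rho> where \<rho>: "\<rho> > 0" "\<And>z. dist z x < \<rho> \<Longrightarrow> \<bar>f z - f x\<bar> < f x / 2"
    using f_cont unfolding continuous_at_eps_delta dist_real_def by blast
  from eventually_radius_less[OF \<rho>(1), of c] show ?thesis
  proof eventually_elim
    case (elim n)
    then show ?case using \<rho>(2) by (force simp: dist_commute intro: less_imp_le)
  qed
qed

section \<open>Ball probabilities, counts and their fluctuations\<close>

lemma prob_cball_approx:
  assumes "\<And>z. z \<in> cball x r \<Longrightarrow> \<bar>f z - f x\<bar> \<le> e"
  shows "\<bar>measure D (cball x r) - f x * measure lborel (cball x r)\<bar> \<le> e * measure lborel (cball x r)"
  using integral_density_cball_approx[of f "\<lambda>_. 1 :: real" x r 1 "f x" e] assms f_nonneg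
  by simp

lemma centered_sum_second_moment:
  assumes h: "h \<in> borel_measurable borel" "\<And>z. \<bar>h z\<bar> \<le> B"
  shows "integrable M (\<lambda>\<omega>. (centered_sum h n \<omega>)\<^sup>2)"
    and "expectation (\<lambda>\<omega>. (centered_sum h n \<omega>)\<^sup>2) \<le> real n * (\<integral>z. (h z)\<^sup>2 \<partial>D)"
proof -
  have "indep_vars (\<lambda>_. borel) Xs {1..n}"
    by (rule indep_vars_subset[OF indep]) auto
  from second_moment_sum_le[OF this _ distr_Xs h]
  show "integrable M (\<lambda>\<omega>. (centered_sum h n \<omega>)\<^sup>2)"
    and "expectation (\<lambda>\<omega>. (centered_sum h n \<omega>)\<^sup>2) \<le> real n * (\<integral>z. (h z)\<^sup>2 \<partial>D)"
    unfolding centered_sum_def by simp_all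
qed

lemma centered_sum_measurable [measurable]:
  "h \<in> borel_measurable borel \<Longrightarrow> centered_sum h n \<in> borel_measurable M"
  unfolding centered_sum_def[abs_def]
  by (intro borel_measurable_sum borel_measurable_diff measurable_compose[OF Xs_measurable]) auto

text \<open>Splitting a count into fluctuation and mean opens it to the second moment bound, and
  also yields the measurability of \<open>likely\<close>.\<close>

lemma card_cball_eq_centered_sum:
  "real (card {i \<in> {1..n}. dist x (Xs i \<omega>) \<le> r})
     = centered_sum (indicator (cball x r)) n \<omega> + real n * measure D (cball x r)"
proof -
  have "real (card {i \<in> {1..n}. dist x (Xs i \<omega>) \<le> r}) = (\<Sum>i\<in>{1..n}. indicator (cball x r) (Xs i \<omega>))"
    by (simp add: indicator_def sum.If_cases Int_def)
  then show ?thesis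
    by (simp add: centered_sum_def sum_subtractf)
qed

lemma likely_measurable: "likely n \<in> sets M"
proof -
  have "likely n = {\<omega> \<in> space M. real (k n) \<le>
      centered_sum (indicator (cball x (4 * radius n))) n \<omega> + real n * measure D (cball x (4 * radius n))}"
    unfolding likely_def card_cball_eq_centered_sum[symmetric] by simp
  moreover have [measurable]: "centered_sum (indicator (cball x (4 * radius n))) n \<in> borel_measurable M"
    by (intro centered_sum_measurable borel_measurable_indicator) simp
  ultimately show ?thesis by simp
qed

text \<open>The count in the ball of radius \<open>4 * radius n\<close> has mean at least
  \<open>2 k\<close>, and Chebyshev's inequality bounds the probability that it falls below
  \<open>k\<close> by \<open>2 / k\<close>.\<close>

lemma likely_prob: "(\<lambda>n. prob (likely n)) \<longlonglongrightarrow> 1"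
proof -
  have ge: "\<forall>\<^sub>F n in sequentially. prob (likely n) \<ge> 1 - 2 / real (k n)"
    using eventually_density_close[of 4, simplified] eventually_ge_at_top[of 1]
  proof eventually_elim
    case (elim n)
    define B where "B = cball x (4 * radius n)"
    define T where "T = centered_sum (indicator B) n"
    define p where "p = measure D B"
    have k: "k n \<ge> 1" using k_range elim by simp
    have "f x * measure lborel B \<ge> 4 * (real (k n) / real n)"
    proof -
      have "(4::real) ^ 1 \<le> 4 ^ DIM('a)"
        using DIM_positive[where 'a = 'a] by (intro power_increasing) (auto simp: Suc_le_eq)
      then show ?thesis
        unfolding B_def by (subst volume_cball) (auto intro!: mult_right_mono divide_right_mono)
    qed
    moreover have "\<bar>p - f x * measure lborel B\<bar> \<le> f x / 2 * measure lborel B"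
      unfolding p_def B_def using elim(1) by (intro prob_cball_approx) auto
    ultimately have "p \<ge> 2 * (real (k n) / real n)" by linarith
    then have np: "real n * p \<ge> 2 * real (k n)"
      using elim(2) by (simp add: field_simps)
    have ind: "indicator B \<in> borel_measurable borel" "\<bar>indicator B z\<bar> \<le> (1::real)" for z
      by (simp_all add: B_def indicator_def[abs_def])
    have T_int: "integrable M (\<lambda>\<omega>. (T \<omega>)\<^sup>2)"
      unfolding T_def by (rule centered_sum_second_moment[OF ind])
    have "expectation (\<lambda>\<omega>. (T \<omega>)\<^sup>2) \<le> real n * (\<integral>z. (indicator B z)\<^sup>2 \<partial>D)"
      unfolding T_def by (rule centered_sum_second_moment[OF ind])
    also have "(\<integral>z. (indicator B z)\<^sup>2 \<partial>D) = p"
      by (simp add: p_def B_def power2_eq_square flip: indicator_inter_arith)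
    finally have T2: "expectation (\<lambda>\<omega>. (T \<omega>)\<^sup>2) \<le> real n * p" .
    have [measurable]: "T \<in> borel_measurable M"
      unfolding T_def by (rule centered_sum_measurable[OF ind(1)])
    \<comment> \<open>Off \<open>likely n\<close> the fluctuation satisfies
      \<open>T < k - n p\<close>, and \<open>n p \<ge> 2 k\<close> makes the right side at most
      \<open>- n p / 2\<close>.\<close>
    have "space M - likely n \<subseteq> {\<omega> \<in> space M. \<bar>T \<omega>\<bar> \<ge> real n * p / 2}"
    proof safe
      fix \<omega> assume \<omega>: "\<omega> \<in> space M" "\<omega> \<notin> likely n"
      then have "T \<omega> + real n * p < real (k n)"
        unfolding likely_def T_def B_def p_def card_cball_eq_centered_sum[symmetric] by simp
      with np show "real n * p / 2 \<le> \<bar>T \<omega>\<bar>" by linarith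
    qed
    then have "prob (space M - likely n) \<le> prob {\<omega> \<in> space M. \<bar>T \<omega>\<bar> \<ge> real n * p / 2}"
      by (rule finite_measure_mono) measurable
    also have "\<dots> \<le> expectation (\<lambda>\<omega>. (T \<omega>)\<^sup>2) / (real n * p / 2)\<^sup>2"
      using T_int np k by (intro second_moment_method) auto
    also have "\<dots> \<le> real n * p / (real n * p / 2)\<^sup>2"
      using T2 by (rule divide_right_mono) simp
    also have "\<dots> = 4 / (real n * p)"
      by (simp add: power2_eq_square)
    also have "\<dots> \<le> 4 / (2 * real (k n))"
      using np k by (intro divide_left_mono) auto
    finally show ?case
      using prob_compl[OF likely_measurable] by simp
  qed
  have "(\<lambda>n. 1 - 2 / real (k n)) \<longlonglongrightarrow> 1 - 0"
    by (intro tendsto_diff tendsto_const tendsto_divide_0[OF tendsto_const] filterlim_at_top_imp_at_infinity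
        filterlim_compose[OF filterlim_real_sequentially k_inf])
  then have "(\<lambda>n. 1 - 2 / real (k n)) \<longlonglongrightarrow> 1" by simp
  from tendsto_sandwich[OF ge _ this tendsto_const] show ?thesis by simp
qed

text \<open>The second moment of the sum is at most \<open>n\<close> times the squared height
  \<open>C * radius n\<close> times the ball probability, hence of order \<open>k\<close> times the
  squared radius. Dividing by the squares of \<open>k\<close> and of the rate leaves a multiple of
  the squared radius, which tends to \<open>0\<close>.\<close>

lemma centered_sum_small_o_P:
  assumes h [measurable]: "\<And>n. h n \<in> borel_measurable borel"
    and h_le: "\<And>n z. \<bar>h n z\<bar> \<le> C * radius n * indicator (cball x (radius n)) z"
  shows "small_o_P M (\<lambda>n \<omega>. ennreal \<bar>c / real (k n) * centered_sum (h n) n \<omega>\<bar>)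
    (\<lambda>n. real (k n) powr (- 1 / 2))"
proof (rule small_o_P_second_moment)
  show "finite_measure M" by unfold_locales
  \<comment> \<open>This crude bound over the whole space serves integrability only; the size of the
    second moment comes from the support.\<close>
  have bounded: "\<bar>h n z\<bar> \<le> \<bar>C\<bar> * radius n" for n z
    using h_le[of n z] by (auto simp: indicator_def mult_right_mono split: if_splits intro: order_trans)
  show "(\<lambda>\<omega>. c / real (k n) * centered_sum (h n) n \<omega>) \<in> borel_measurable M" for n
    by measurable
  show "integrable M (\<lambda>\<omega>. (c / real (k n) * centered_sum (h n) n \<omega>)\<^sup>2)" for n
    unfolding power_mult_distrib
    by (intro integrable_mult_right centered_sum_second_moment[OF h bounded])
  show "\<forall>\<^sub>F n in sequentially. real (k n) powr (- 1 / 2) > 0"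
    using eventually_ge_at_top[of 1] by eventually_elim (use k_range in fastforce)
  let ?Q = "\<lambda>n. expectation (\<lambda>\<omega>. (c / real (k n) * centered_sum (h n) n \<omega>)\<^sup>2)
      / (real (k n) powr (- 1 / 2))\<^sup>2"
  have le: "\<forall>\<^sub>F n in sequentially. ?Q n \<le> 2 * c\<^sup>2 * C\<^sup>2 * (radius n)\<^sup>2"
    using eventually_density_close[of 1, simplified] eventually_ge_at_top[of 1]
  proof eventually_elim
    case (elim n)
    let ?B = "cball x (radius n)"
    have k: "k n \<ge> 1" using k_range elim by simp
    have fB: "f x * measure lborel ?B = real (k n) / real n"
      using volume_cball[of 1 n] by simp
    have "\<bar>measure D ?B - f x * measure lborel ?B\<bar> \<le> f x / 2 * measure lborel ?B"
      using elim(1) by (intro prob_cball_approx) auto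
    \<comment> \<open>The factor \<open>3/2\<close> from the density tolerance is rounded up to
      \<open>2\<close>.\<close>
    then have "measure D ?B \<le> 2 * (real (k n) / real n)"
      using fB by linarith
    then have p: "real n * measure D ?B \<le> 2 * real (k n)"
      using elim(2) by (simp add: field_simps)
    have "(\<integral>z. (h n z)\<^sup>2 \<partial>D) \<le> (\<integral>z. (C * radius n)\<^sup>2 * indicator ?B z \<partial>D)"
    proof (rule integral_mono')
      show "(h n z)\<^sup>2 \<le> (C * radius n)\<^sup>2 * indicator ?B z" for z
        using power_mono[OF h_le abs_ge_zero, of n z 2]
        by (cases "z \<in> ?B") (simp_all add: power_mult_distrib)
      show "integrable D (\<lambda>z. (C * radius n)\<^sup>2 * indicator ?B z)"
        by (intro integrable_mult_right integrable_real_indicator) (simp_all add: less_top[symmetric])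
    qed simp
    also have "\<dots> = (C * radius n)\<^sup>2 * measure D ?B" by simp
    finally have "real n * (\<integral>z. (h n z)\<^sup>2 \<partial>D) \<le> (C * radius n)\<^sup>2 * (real n * measure D ?B)"
      using mult_left_mono[of _ _ "real n"] by (fastforce simp: mult_ac)
    also have "\<dots> \<le> (C * radius n)\<^sup>2 * (2 * real (k n))"
      using p by (intro mult_left_mono) auto
    finally have E: "expectation (\<lambda>\<omega>. (centered_sum (h n) n \<omega>)\<^sup>2) \<le> (C * radius n)\<^sup>2 * (2 * real (k n))"
      using centered_sum_second_moment(2)[OF h bounded, of n n] by linarith
    have "(real (k n) powr (- 1 / 2))\<^sup>2 = 1 / real (k n)"
    proof -
      have "(real (k n) powr (- 1 / 2))\<^sup>2 = real (k n) powr (- 1)"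
        by (simp add: power2_eq_square flip: powr_add)
      also have "\<dots> = 1 / real (k n)" using k by (simp add: powr_minus_divide)
      finally show ?thesis .
    qed
    then have "?Q n = c\<^sup>2 / real (k n) * expectation (\<lambda>\<omega>. (centered_sum (h n) n \<omega>)\<^sup>2)"
      using k unfolding power_mult_distrib integral_mult_right_zero
      by (simp add: power2_eq_square[of "real (k n)"] power_divide)
    also have "\<dots> \<le> c\<^sup>2 / real (k n) * ((C * radius n)\<^sup>2 * (2 * real (k n)))"
      using E by (rule mult_left_mono) simp
    also have "\<dots> = 2 * c\<^sup>2 * C\<^sup>2 * (radius n)\<^sup>2"
      using k by (simp add: power_mult_distrib)
    finally show ?case .
  qed
  have "(\<lambda>n. 2 * c\<^sup>2 * C\<^sup>2 * (radius n)\<^sup>2) \<longlonglongrightarrow> 2 * c\<^sup>2 * C\<^sup>2 * 0\<^sup>2"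
    by (intro tendsto_intros radius_tendsto_0)
  then have lim: "(\<lambda>n. 2 * c\<^sup>2 * C\<^sup>2 * (radius n)\<^sup>2) \<longlonglongrightarrow> 0" by simp
  show "?Q \<longlonglongrightarrow> 0"
    by (rule tendsto_sandwich[OF _ le tendsto_const lim]) simp
qed

section \<open>Distances and mean displacement of the neighbours\<close>

abbreviation neighbors :: "nat \<Rightarrow> 'w \<Rightarrow> nat set" where
  "neighbors n \<omega> \<equiv> nearest_neighbors (\<lambda>i. Xs i \<omega>) n (k n) x"

lemma likely_dist_le:
  "\<omega> \<in> likely n \<Longrightarrow> i \<in> neighbors n \<omega> \<Longrightarrow> dist x (Xs i \<omega>) \<le> 4 * radius n"
  unfolding likely_def
  using nearest_neighbors_dist_le[where p = "\<lambda>i. Xs i \<omega>" and n = n and k = "k n" and x = x] by blast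

lemma neighbors_mean_le:
  assumes "n \<ge> 1" "\<And>i. i \<in> neighbors n \<omega> \<Longrightarrow> \<bar>u i\<bar> \<le> b"
  shows "\<bar>(1 / real (k n)) * (\<Sum>i\<in>neighbors n \<omega>. u i)\<bar> \<le> b"
proof -
  have k: "1 \<le> k n" "k n \<le> n" using k_range assms(1) by auto
  have "\<bar>\<Sum>i\<in>neighbors n \<omega>. u i\<bar> \<le> (\<Sum>i\<in>neighbors n \<omega>. b)"
    using assms(2) by (intro order_trans[OF sum_abs] sum_mono)
  also have "\<dots> = real (k n) * b"
    using k by (simp add: card_nearest_neighbors)
  finally show ?thesis
    using k by (simp add: abs_mult field_simps)
qed

text \<open>The neighbours and the points within \<open>radius n\<close> are nested sets, so exchanging one for the
  other costs their difference in cardinality times a radius.\<close>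

lemma neighbors_displacement_le:
  assumes lip: "L-lipschitz_on (ball x \<rho>) f" and "\<rho> > 0"
  defines "h \<equiv> \<lambda>b n z. indicator (cball x (radius n)) z * ((z - x) \<bullet> b)"
    and "h0 \<equiv> \<lambda>n z. 4 * radius n * indicator (cball x (radius n)) z"
  shows "\<forall>\<^sub>F n in sequentially. \<forall>\<omega>\<in>likely n.
    norm (\<Sum>i\<in>neighbors n \<omega>. Xs i \<omega> - x)
      \<le> real (k n) * (5 * L / f x * (radius n)\<^sup>2)
        + (\<Sum>b\<in>Basis. \<bar>centered_sum (h b n) n \<omega>\<bar>) + \<bar>centered_sum (h0 n) n \<omega>\<bar>"
  using eventually_radius_less[OF \<open>\<rho> > 0\<close>, of 1] eventually_ge_at_top[of 1]
proof (eventually_elim, intro ballI)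
  fix n \<omega> assume rad: "1 * radius n < \<rho>" and n: "n \<ge> 1" and \<omega>: "\<omega> \<in> likely n"
  define r where "r = radius n"
  define S where "S = cball x r"
  define N where "N = neighbors n \<omega>"
  define B where "B = {i \<in> {1..n}. dist x (Xs i \<omega>) \<le> r}"
  define p where "p = measure D S"
  define \<phi> where "\<phi> z = indicator S z *\<^sub>R (z - x)" for z
  \<comment> \<open>\<open>q\<close> is the unit of bias: the mean displacement in the ball
    contributes one \<open>q\<close> and the bias of the count contributes four, which explains the
    \<open>5\<close> in the claim.\<close>
  define q where "q = real (k n) * (L * r / f x) * r"
  define m where "m = (\<integral>z. \<phi> z \<partial>D)"
  have [measurable]: "S \<in> sets borel" by (simp add: S_def)
  have k: "1 \<le> k n" "k n \<le> n" using k_range n by auto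
  have r: "r \<ge> 0" by (simp add: r_def)
  have L: "L \<ge> 0" using lipschitz_on_nonneg[OF lip] .
  have vol: "f x * measure lborel S = real (k n) / real n"
    using volume_cball[of 1 n] by (simp add: S_def r_def)
  have f_le: "\<bar>f z - f x\<bar> \<le> L * r" if "z \<in> cball x r" for z
  proof -
    have "dist (f z) (f x) \<le> L * dist z x"
      using that rad \<open>\<rho> > 0\<close> by (intro lipschitz_onD[OF lip]) (auto simp: r_def)
    also have "\<dots> \<le> L * r"
      using that L by (intro mult_left_mono) (auto simp: dist_commute)
    finally show ?thesis by (simp add: dist_real_def)
  qed
  have Lvol: "real n * (L * r * measure lborel S) = real (k n) * (L * r / f x)"
  proof -
    have "measure lborel S = real (k n) / real n / f x"
      using f_pos by (simp flip: vol)
    then show ?thesis using n by simp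
  qed
  have p: "\<bar>real n * p - real (k n)\<bar> \<le> real (k n) * (L * r / f x)"
  proof -
    have "\<bar>p - f x * measure lborel S\<bar> \<le> L * r * measure lborel S"
      unfolding p_def S_def by (rule prob_cball_approx) (rule f_le)
    then have "real n * \<bar>p - real (k n) / real n\<bar> \<le> real n * (L * r * measure lborel S)"
      unfolding vol by (rule mult_left_mono) simp
    moreover have "real n * \<bar>p - real (k n) / real n\<bar> = \<bar>real n * p - real (k n)\<bar>"
      using n by (simp add: abs_mult_pos' right_diff_distrib)
    ultimately show ?thesis using Lvol by simp
  qed
  \<comment> \<open>By symmetry the constant part \<open>f x\<close> of the density contributes
    nothing; what remains is the Lipschitz error \<open>L * r\<close> times a displacement of at
    most \<open>r\<close>.\<close>
  have m: "real n * norm m \<le> real (k n) * (L * r / f x) * r"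
  proof -
    have "norm (m - f x *\<^sub>R (\<integral>z. \<phi> z \<partial>lborel)) \<le> L * r * r * measure lborel S"
      unfolding m_def \<phi>_def S_def
      by (rule integral_density_cball_approx)
         (use f_nonneg f_le in \<open>auto simp: dist_norm norm_minus_commute\<close>)
    then have "norm m \<le> L * r * measure lborel S * r"
      by (simp add: \<phi>_def S_def integral_cball_symmetric mult_ac)
    from mult_left_mono[OF this, of "real n"] show ?thesis
      using Lvol by (simp add: mult.assoc[symmetric])
  qed
  have \<phi>_int: "integrable D \<phi>"
  proof (rule D.integrable_const_bound[of _ r])
    show "AE z in D. norm (\<phi> z) \<le> r"
      using r by (intro AE_I2) (auto simp: \<phi>_def S_def dist_norm norm_minus_commute indicator_def)
  qed (unfold \<phi>_def, measurable)
  have h_eq: "h b n z = \<phi> z \<bullet> b" for b z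
    by (simp add: h_def \<phi>_def S_def r_def)
  have h: "centered_sum (h b n) n \<omega> = (\<Sum>i\<in>{1..n}. \<phi> (Xs i \<omega>) - m) \<bullet> b" for b
  proof -
    have "(\<integral>z. h b n z \<partial>D) = m \<bullet> b"
      unfolding h_eq m_def using \<phi>_int by (rule integral_inner_left)
    then show ?thesis
      by (simp add: centered_sum_def h_eq inner_sum_left inner_diff_left)
  qed
  \<comment> \<open>With the factor \<open>4 * r\<close> inside \<open>h0\<close>, the cost of the
    count fluctuation is itself a centered sum of the kind shown to be of small order.\<close>
  have h0: "centered_sum (h0 n) n \<omega> = 4 * r * centered_sum (indicator S) n \<omega>"
    by (simp add: centered_sum_def h0_def r_def S_def sum_distrib_left right_diff_distrib)
  have "(\<Sum>i\<in>B. Xs i \<omega> - x) = (\<Sum>i\<in>{1..n}. \<phi> (Xs i \<omega>))"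
  proof -
    have "(\<Sum>i\<in>{1..n}. \<phi> (Xs i \<omega>)) = (\<Sum>i\<in>{1..n}. if dist x (Xs i \<omega>) \<le> r then Xs i \<omega> - x else 0)"
      by (intro sum.cong refl) (simp add: \<phi>_def S_def)
    also have "\<dots> = (\<Sum>i\<in>B. Xs i \<omega> - x)"
      unfolding B_def by (rule sum.inter_filter[symmetric]) simp
    finally show ?thesis by simp
  qed
  also have "\<dots> = (\<Sum>i\<in>{1..n}. \<phi> (Xs i \<omega>) - m) + real n *\<^sub>R m"
    by (simp add: sum_subtractf sum_constant_scaleR)
  also have "norm \<dots> \<le> norm (\<Sum>i\<in>{1..n}. \<phi> (Xs i \<omega>) - m) + real n * norm m"
    by (rule order_trans[OF norm_triangle_ineq]) simp
  \<comment> \<open>Passing to coordinates reduces the vector fluctuation to real centered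
    sums.\<close>
  also have "norm (\<Sum>i\<in>{1..n}. \<phi> (Xs i \<omega>) - m) \<le> (\<Sum>b\<in>Basis. \<bar>centered_sum (h b n) n \<omega>\<bar>)"
    unfolding h by (rule norm_le_l1)
  finally have sum_B: "norm (\<Sum>i\<in>B. Xs i \<omega> - x)
      \<le> (\<Sum>b\<in>Basis. \<bar>centered_sum (h b n) n \<omega>\<bar>) + q"
    using m unfolding q_def by linarith
  have "norm ((\<Sum>i\<in>N. Xs i \<omega> - x) - (\<Sum>i\<in>B. Xs i \<omega> - x)) \<le> \<bar>real (card N) - real (card B)\<bar> * (4 * r)"
  proof (rule norm_sum_diff_nested_le)
    show "N \<subseteq> B \<or> B \<subseteq> N"
      unfolding N_def B_def
      using nearest_neighbors_nested[where p = "\<lambda>i. Xs i \<omega>" and n = n and k = "k n" and x = x and r = r]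
      by (simp add: disj_commute)
    fix i assume "i \<in> N \<union> B"
    then have "dist x (Xs i \<omega>) \<le> 4 * r"
    proof
      assume "i \<in> N"
      with likely_dist_le[OF \<omega>] show ?thesis by (simp add: N_def r_def)
    next
      assume "i \<in> B"
      with r show ?thesis by (simp add: B_def)
    qed
    then show "norm (Xs i \<omega> - x) \<le> 4 * r" by (simp add: dist_norm norm_minus_commute)
  qed (auto simp: N_def B_def)
  \<comment> \<open>There are exactly \<open>k\<close> neighbours, so the difference in cardinality
    splits into the fluctuation of the count and the bias \<open>n p - k\<close>.\<close>
  also have "\<dots> \<le> (\<bar>centered_sum (indicator S) n \<omega>\<bar> + real (k n) * (L * r / f x)) * (4 * r)"
  proof (rule mult_right_mono)
    have "real (card B) = centered_sum (indicator S) n \<omega> + real n * p"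
      unfolding B_def S_def p_def by (rule card_cball_eq_centered_sum)
    moreover have "card N = k n"
      unfolding N_def using k by (intro card_nearest_neighbors)
    ultimately show "\<bar>real (card N) - real (card B)\<bar>
        \<le> \<bar>centered_sum (indicator S) n \<omega>\<bar> + real (k n) * (L * r / f x)"
      using p by linarith
  qed (use r in simp)
  also have "\<dots> = \<bar>centered_sum (h0 n) n \<omega>\<bar> + 4 * q"
    using r unfolding h0 q_def by (simp add: abs_mult algebra_simps)
  finally have "norm (\<Sum>i\<in>N. Xs i \<omega> - x) \<le> norm (\<Sum>i\<in>B. Xs i \<omega> - x)
      + (\<bar>centered_sum (h0 n) n \<omega>\<bar> + 4 * q)"
    using norm_triangle_sub[of "\<Sum>i\<in>N. Xs i \<omega> - x" "\<Sum>i\<in>B. Xs i \<omega> - x"] by linarith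
  moreover have "real (k n) * (5 * L / f x * r\<^sup>2) = 5 * q"
    by (simp add: q_def power2_eq_square)
  ultimately show "norm (\<Sum>i\<in>neighbors n \<omega>. Xs i \<omega> - x)
      \<le> real (k n) * (5 * L / f x * (radius n)\<^sup>2)
        + (\<Sum>b\<in>Basis. \<bar>centered_sum (h b n) n \<omega>\<bar>) + \<bar>centered_sum (h0 n) n \<omega>\<bar>"
    using sum_B unfolding N_def r_def by linarith
qed

section \<open>Rates for a class of functions\<close>

definition radius_scale :: real where
  "radius_scale = (1 / (f x * measure lborel (cball (0::'a) 1))) powr (1 / real DIM('a))"

lemma radius_scale_pos: "radius_scale > 0"
  using f_pos volume_pos unfolding radius_scale_def by simp

lemma radius_eq: "radius n = radius_scale * (real (k n) / real n) powr (1 / real DIM('a))"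
proof -
  have "radius n
      = (1 / (f x * measure lborel (cball (0::'a) 1)) * (real (k n) / real n)) powr (1 / real DIM('a))"
    unfolding radius_def by (simp add: mult.commute)
  also have "\<dots> = radius_scale * (real (k n) / real n) powr (1 / real DIM('a))"
    unfolding radius_scale_def by (rule powr_mult)
  finally show ?thesis .
qed

lemma radius_sq_eq: "(radius n)\<^sup>2 = radius_scale\<^sup>2 * (real (k n) / real n) powr (2 / real DIM('a))"
  unfolding radius_eq by (simp add: power_mult_distrib power2_eq_square flip: powr_add)

text \<open>\<open>H\<close> consists of plain functions of the covariate; in the application these
  are the maps taking \<open>z\<close> to the integral of \<open>g\<close> under
  \<open>\<mu> z\<close>.\<close>

definition deviation :: "('a \<Rightarrow> real) set \<Rightarrow> nat \<Rightarrow> 'w \<Rightarrow> ennreal" where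
  "deviation H n \<omega> = (SUP h\<in>H. ennreal \<bar>(1 / real (k n)) * (\<Sum>i\<in>neighbors n \<omega>. h (Xs i \<omega>) - h x)\<bar>)"

text \<open>On \<open>likely n\<close> every neighbour is within \<open>4 * radius n\<close>, so
  each summand is at most \<open>L * (4 * radius n)\<close> uniformly in \<open>h\<close>. The
  small-order term then only has to absorb the exceptional events.\<close>

lemma deviation_Lipschitz:
  assumes "\<tau> > 0" "L > 0"
    and lip: "\<And>h z. h \<in> H \<Longrightarrow> z \<in> cball x \<tau> \<Longrightarrow> \<bar>h x - h z\<bar> \<le> L * norm (x - z)"
  shows "O_P_plus_o_P M (deviation H) (\<lambda>n. (real (k n) / real n) powr (1 / real DIM('a)))
    (\<lambda>n. real (k n) powr (- 1 / 2))"
proof (rule O_P_plus_o_P_on_likely_events[OF prob_space_axioms likely_measurable likely_prob small_o_P_0])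
  show "4 * L * radius_scale > 0" using \<open>L > 0\<close> radius_scale_pos by simp
  show "\<forall>\<^sub>F n in sequentially. \<forall>\<omega>\<in>likely n. deviation H n \<omega>
      \<le> ennreal (4 * L * radius_scale * (real (k n) / real n) powr (1 / real DIM('a))) + 0"
    using eventually_radius_less[OF \<open>\<tau> > 0\<close>, of 4] eventually_ge_at_top[of 1]
  proof eventually_elim
    case (elim n)
    show ?case
    proof
      fix \<omega> assume \<omega>: "\<omega> \<in> likely n"
      have "\<bar>(1 / real (k n)) * (\<Sum>i\<in>neighbors n \<omega>. h (Xs i \<omega>) - h x)\<bar> \<le> L * (4 * radius n)"
        if h: "h \<in> H" for h
      proof (rule neighbors_mean_le[OF elim(2)])
        fix i assume "i \<in> neighbors n \<omega>"
        from likely_dist_le[OF \<omega> this] have d: "dist x (Xs i \<omega>) \<le> 4 * radius n" .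
        then have "Xs i \<omega> \<in> cball x \<tau>" using elim(1) by simp
        from lip[OF h this] have "\<bar>h (Xs i \<omega>) - h x\<bar> \<le> L * norm (x - Xs i \<omega>)"
          by (simp add: abs_minus_commute)
        also have "\<dots> \<le> L * (4 * radius n)"
          using d \<open>L > 0\<close> by (intro mult_left_mono) (auto simp: dist_norm)
        finally show "\<bar>h (Xs i \<omega>) - h x\<bar> \<le> L * (4 * radius n)" .
      qed
      then have "deviation H n \<omega> \<le> ennreal (L * (4 * radius n))"
        unfolding deviation_def by (intro SUP_least ennreal_leI)
      also have "L * (4 * radius n)
          = 4 * L * radius_scale * (real (k n) / real n) powr (1 / real DIM('a))"
        by (simp add: radius_eq)
      finally show "deviation H n \<omega>
          \<le> ennreal (4 * L * radius_scale * (real (k n) / real n) powr (1 / real DIM('a))) + 0"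
        by simp
    qed
  qed
qed

text \<open>Each increment is its linear part at \<open>x\<close> plus a quadratic remainder. The
  linear parts add up to the inner product of the gradient with the total displacement, so a uniform
  gradient bound removes \<open>h\<close> before the supremum is taken.\<close>

lemma deviation_Lipschitz_gradient:
  assumes "\<tau> > 0" "L > 0"
    and lip: "\<And>h z. h \<in> H \<Longrightarrow> z \<in> cball x \<tau> \<Longrightarrow> \<bar>h x - h z\<bar> \<le> L * norm (x - z)"
    and "\<tau>' > 0" "L' > 0"
    and diff: "\<And>h z. h \<in> H \<Longrightarrow> z \<in> cball x \<tau>' \<Longrightarrow> h differentiable (at z)"
    and grad: "\<And>h z. h \<in> H \<Longrightarrow> z \<in> cball x \<tau>' \<Longrightarrow>
      norm (gradient h x - gradient h z) \<le> L' * norm (x - z)"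
    and "\<rho> > 0" and f_lip: "Lf-lipschitz_on (ball x \<rho>) f"
  shows "O_P_plus_o_P M (deviation H) (\<lambda>n. (real (k n) / real n) powr (2 / real DIM('a)))
    (\<lambda>n. real (k n) powr (- 1 / 2))"
proof -
  define \<phi> where "\<phi> b n z = indicator (cball x (radius n)) z * ((z - x) \<bullet> b)" for b n z
  define \<psi> where "\<psi> n z = 4 * radius n * indicator (cball x (radius n)) z" for n and z :: 'a
  define V where "V n \<omega> = (\<Sum>b\<in>Basis. ennreal \<bar>L / real (k n) * centered_sum (\<phi> b n) n \<omega>\<bar>)
      + ennreal \<bar>L / real (k n) * centered_sum (\<psi> n) n \<omega>\<bar>" for n \<omega>
  \<comment> \<open>\<open>16\<close> is the square of the factor \<open>4\<close> in the neighbour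
    radius, for the remainder; the term with \<open>5\<close> is the displacement bias times the
    gradient bound \<open>L\<close>. The scale turns the squared radius into the rate.\<close>
  define K where "K = (16 * L' + 5 * L * Lf / f x) * radius_scale\<^sup>2"
  have fm: "finite_measure M" by unfold_locales
  have [measurable]: "cball x r \<in> sets borel" for r by simp
  have \<phi>: "small_o_P M (\<lambda>n \<omega>. ennreal \<bar>L / real (k n) * centered_sum (\<phi> b n) n \<omega>\<bar>)
      (\<lambda>n. real (k n) powr (- 1 / 2))" if b: "b \<in> Basis" for b
  proof (rule centered_sum_small_o_P)
    show "\<phi> b n \<in> borel_measurable borel" for n
      unfolding \<phi>_def[abs_def] by measurable
    show "\<bar>\<phi> b n z\<bar> \<le> 1 * radius n * indicator (cball x (radius n)) z" for n z
    proof (cases "z \<in> cball x (radius n)")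
      case True
      have "\<bar>(z - x) \<bullet> b\<bar> \<le> norm (z - x)" using b by (rule Basis_le_norm)
      with True show ?thesis by (simp add: \<phi>_def dist_norm norm_minus_commute)
    qed (simp add: \<phi>_def)
  qed
  have \<psi>: "small_o_P M (\<lambda>n \<omega>. ennreal \<bar>L / real (k n) * centered_sum (\<psi> n) n \<omega>\<bar>)
      (\<lambda>n. real (k n) powr (- 1 / 2))"
  proof (rule centered_sum_small_o_P)
    show "\<psi> n \<in> borel_measurable borel" for n
      unfolding \<psi>_def[abs_def] by measurable
    show "\<bar>\<psi> n z\<bar> \<le> 4 * radius n * indicator (cball x (radius n)) z" for n z
      by (simp add: \<psi>_def)
  qed
  have V: "small_o_P M V (\<lambda>n. real (k n) powr (- 1 / 2))"
    unfolding V_def[abs_def] by (intro small_o_P_add small_o_P_sum fm \<phi> \<psi> finite_Basis)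
  have "Lf \<ge> 0" using lipschitz_on_nonneg[OF f_lip] .
  then have K: "K > 0"
    using \<open>L > 0\<close> \<open>L' > 0\<close> f_pos radius_scale_pos unfolding K_def
    by (intro mult_pos_pos add_pos_nonneg) auto
  show ?thesis
  proof (rule O_P_plus_o_P_on_likely_events[OF prob_space_axioms likely_measurable likely_prob V K])
    show "\<forall>\<^sub>F n in sequentially. \<forall>\<omega>\<in>likely n. deviation H n \<omega>
        \<le> ennreal (K * (real (k n) / real n) powr (2 / real DIM('a))) + V n \<omega>"
      using neighbors_displacement_le[OF f_lip \<open>\<rho> > 0\<close>]
        eventually_radius_less[OF \<open>\<tau>' > 0\<close>, of 4] eventually_ge_at_top[of 1]
    proof eventually_elim
      case (elim n)
      show ?case
      proof
        fix \<omega> assume \<omega>: "\<omega> \<in> likely n"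
        have k: "k n > 0" using k_range[OF elim(3)] by simp
        let ?A = "\<Sum>b\<in>Basis. \<bar>L / real (k n) * centered_sum (\<phi> b n) n \<omega>\<bar>"
        let ?C = "\<bar>L / real (k n) * centered_sum (\<psi> n) n \<omega>\<bar>"
        let ?s = "\<Sum>i\<in>neighbors n \<omega>. Xs i \<omega> - x"
        have "L / real (k n) * norm ?s
            \<le> L / real (k n) * (real (k n) * (5 * Lf / f x * (radius n)\<^sup>2)
              + (\<Sum>b\<in>Basis. \<bar>centered_sum (\<phi> b n) n \<omega>\<bar>) + \<bar>centered_sum (\<psi> n) n \<omega>\<bar>)"
          using elim(1) \<omega> \<open>L > 0\<close> unfolding \<phi>_def[abs_def] \<psi>_def[abs_def]
          by (intro mult_left_mono) auto
        also have "\<dots> = 5 * L * Lf / f x * (radius n)\<^sup>2 + ?A + ?C"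
          using k \<open>L > 0\<close> by (simp add: distrib_left abs_mult sum_distrib_left)
        finally have s: "L / real (k n) * norm ?s \<le> 5 * L * Lf / f x * (radius n)\<^sup>2 + ?A + ?C" .
        have "\<bar>(1 / real (k n)) * (\<Sum>i\<in>neighbors n \<omega>. h (Xs i \<omega>) - h x)\<bar>
            \<le> K * (real (k n) / real n) powr (2 / real DIM('a)) + ?A + ?C"
          if h: "h \<in> H" for h
        proof -
          let ?u = "\<lambda>i. h (Xs i \<omega>) - h x - (Xs i \<omega> - x) \<bullet> gradient h x"
          have u: "\<bar>(1 / real (k n)) * (\<Sum>i\<in>neighbors n \<omega>. ?u i)\<bar> \<le> L' * (4 * radius n)\<^sup>2"
          proof (rule neighbors_mean_le[OF elim(3)])
            fix i assume "i \<in> neighbors n \<omega>"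
            from likely_dist_le[OF \<omega> this] have d: "dist x (Xs i \<omega>) \<le> 4 * radius n" .
            then have "Xs i \<omega> \<in> cball x \<tau>'" using elim(2) by simp
            from gradient_linearization_bound[OF diff[OF h] grad[OF h] _ this] \<open>L' > 0\<close>
            have "\<bar>?u i\<bar> \<le> L' * (norm (Xs i \<omega> - x))\<^sup>2" by simp
            also have "\<dots> \<le> L' * (4 * radius n)\<^sup>2"
              using d \<open>L' > 0\<close> by (intro mult_left_mono power_mono) (auto simp: dist_norm norm_minus_commute)
            finally show "\<bar>?u i\<bar> \<le> L' * (4 * radius n)\<^sup>2" .
          qed
          \<comment> \<open>The Lipschitz condition of the first part returns here, as a gradient
            bound common to all of \<open>H\<close>.\<close>
          have "norm (gradient h x) \<le> L"
            using diff[OF h, of x] \<open>\<tau>' > 0\<close> by (intro norm_gradient_le[OF _ \<open>\<tau> > 0\<close> lip[OF h]]) auto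
          then have "\<bar>?s \<bullet> gradient h x\<bar> \<le> norm ?s * L"
            by (intro order_trans[OF Cauchy_Schwarz_ineq2] mult_left_mono) auto
          then have "(1 / real (k n)) * \<bar>?s \<bullet> gradient h x\<bar> \<le> (1 / real (k n)) * (norm ?s * L)"
            by (rule mult_left_mono) simp
          then have "\<bar>(1 / real (k n)) * (?s \<bullet> gradient h x)\<bar> \<le> L / real (k n) * norm ?s"
            by (simp add: abs_mult mult_ac)
          with s have "\<bar>(1 / real (k n)) * (?s \<bullet> gradient h x)\<bar>
              \<le> 5 * L * Lf / f x * (radius n)\<^sup>2 + ?A + ?C" by linarith
          moreover have "(1 / real (k n)) * (\<Sum>i\<in>neighbors n \<omega>. h (Xs i \<omega>) - h x)
              = (1 / real (k n)) * (\<Sum>i\<in>neighbors n \<omega>. ?u i) + (1 / real (k n)) * (?s \<bullet> gradient h x)"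
            unfolding inner_sum_left distrib_left[symmetric] sum.distrib[symmetric] by simp
          moreover have "K * (real (k n) / real n) powr (2 / real DIM('a))
              = L' * (4 * radius n)\<^sup>2 + 5 * L * Lf / f x * (radius n)\<^sup>2"
            by (simp add: K_def radius_sq_eq power_mult_distrib algebra_simps)
          ultimately show ?thesis using u by linarith
        qed
        then have "deviation H n \<omega>
            \<le> ennreal (K * (real (k n) / real n) powr (2 / real DIM('a)) + ?A + ?C)"
          unfolding deviation_def by (intro SUP_least ennreal_leI)
        also have "\<dots> = ennreal (K * (real (k n) / real n) powr (2 / real DIM('a))) + V n \<omega>"
          using K by (simp add: V_def ennreal_plus sum_nonneg sum_ennreal add.assoc)
        finally show "deviation H n \<omega>
            \<le> ennreal (K * (real (k n) / real n) powr (2 / real DIM('a))) + V n \<omega>" .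
      qed
    qed
  qed
qed

end

section \<open>Passage from the joint sample to the covariates\<close>

theorem theorem4:
  fixes M :: "'w measure" and S :: "'s measure"
    and X :: "'w \<Rightarrow> real ^ 'd" and Y :: "'w \<Rightarrow> 's"
    and Xs :: "nat \<Rightarrow> 'w \<Rightarrow> real ^ 'd" and Ys :: "nat \<Rightarrow> 'w \<Rightarrow> 's"
    and f :: "real ^ 'd \<Rightarrow> real" and \<mu> :: "real ^ 'd \<Rightarrow> 's measure"
    and x :: "real ^ 'd" and \<G> :: "('s \<Rightarrow> real) set" and G :: "'s \<Rightarrow> real"
    and \<delta> :: real and k :: "nat \<Rightarrow> nat"
  assumes M: "prob_space M"
    and indep: "prob_space.indep_vars M (\<lambda>_. borel \<Otimes>\<^sub>M S)
          (\<lambda>i \<omega>. if i = 0 then (X \<omega>, Y \<omega>) else (Xs i \<omega>, Ys i \<omega>)) (UNIV :: nat set)"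
    and ident: "\<And>i. i \<ge> 1 \<Longrightarrow>
          distr M (borel \<Otimes>\<^sub>M S) (\<lambda>\<omega>. (Xs i \<omega>, Ys i \<omega>)) = distr M (borel \<Otimes>\<^sub>M S) (\<lambda>\<omega>. (X \<omega>, Y \<omega>))"
    and f_nonneg: "\<And>z. f z \<ge> 0"
    and density: "distributed M lborel X (\<lambda>z. ennreal (f z))"
    and f_x: "isCont f x" "f x > 0"
    and \<mu>: "regular_conditional_distribution M X f S Y \<mu>"
    and \<G>: "\<G> \<subseteq> borel_measurable S"
    and \<delta>: "\<delta> > 0"
    and G: "envelope S \<G> G"
    and cond_i: "\<And>\<delta>s :: nat \<Rightarrow> real. (\<forall>n. \<delta>s n > 0) \<Longrightarrow> \<delta>s \<longlonglongrightarrow> 0 \<Longrightarrow>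
          limsup (\<lambda>n. SUP u\<in>{0<..\<delta>}. bracketing_integral \<G> G (local_law M X S \<mu> x u) (\<delta>s n)) = 0"
    and cond_ii: "\<And>\<epsilon> :: real. \<epsilon> > 0 \<Longrightarrow> \<exists>K>0.
          (SUP u\<in>{0<..\<delta>}. \<integral>\<^sup>+s. ennreal ((G s)\<^sup>2 * indicator {s. G s > K} s) \<partial>local_law M X S \<mu> x u)
            \<le> ennreal \<epsilon>"
    and cond_iii: "totally_bounded_wrt \<G>
          (\<lambda>g\<^sub>1 g\<^sub>2. SUP u\<in>{0<..\<delta>}. L2_norm (local_law M X S \<mu> x u) (\<lambda>s. g\<^sub>1 s - g\<^sub>2 s))"
    and G_sq: "\<forall>\<^sub>F z in nhds x. integrable (\<mu> z) (\<lambda>s. (G s)\<^sup>2)"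
    and cont: "\<And>g\<^sub>1 g\<^sub>2. g\<^sub>1 \<in> \<G> \<Longrightarrow> g\<^sub>2 \<in> \<G> \<Longrightarrow>
          isCont (\<lambda>z. (\<integral>s. g\<^sub>1 s * g\<^sub>2 s \<partial>\<mu> z, \<integral>s. g\<^sub>1 s \<partial>\<mu> z, \<integral>s. (G s)\<^sup>2 \<partial>\<mu> z)) x"
    and k_range: "\<And>n. n \<ge> 1 \<Longrightarrow> 1 \<le> k n \<and> k n \<le> n"
    and k_inf: "filterlim k at_top sequentially"
    and k_n: "(\<lambda>n. real (k n) / real n) \<longlonglongrightarrow> 0"
  shows
    "((\<exists>\<tau>>0. \<exists>L\<^sub>1>0. \<forall>z\<in>cball x \<tau>. \<forall>g\<in>\<G>.
         \<bar>(\<integral>s. g s \<partial>\<mu> x) - (\<integral>s. g s \<partial>\<mu> z)\<bar> \<le> L\<^sub>1 * norm (x - z))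
      \<longrightarrow> O_P_plus_o_P M (nn_sup_deviation Xs \<mu> \<G> k x)
            (\<lambda>n. (real (k n) / real n) powr (1 / real CARD('d)))
            (\<lambda>n. real (k n) powr (- 1 / 2)))
     \<and>
     ((\<exists>\<tau>>0. \<exists>L\<^sub>1>0. \<forall>z\<in>cball x \<tau>. \<forall>g\<in>\<G>.
         \<bar>(\<integral>s. g s \<partial>\<mu> x) - (\<integral>s. g s \<partial>\<mu> z)\<bar> \<le> L\<^sub>1 * norm (x - z))
      \<and> (\<exists>\<tau>>0. \<exists>L\<^sub>2>0. \<forall>z\<in>cball x \<tau>. \<forall>g\<in>\<G>.
         (\<lambda>w. \<integral>s. g s \<partial>\<mu> w) differentiable (at z) \<and>
         norm (gradient (\<lambda>w. \<integral>s. g s \<partial>\<mu> w) x - gradient (\<lambda>w. \<integral>s. g s \<partial>\<mu> w) z) \<le> L\<^sub>2 * norm (x - z))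
      \<and> (\<exists>r>0. \<exists>L\<^sub>f. L\<^sub>f-lipschitz_on (ball x r) f)
      \<longrightarrow> O_P_plus_o_P M (nn_sup_deviation Xs \<mu> \<G> k x)
            (\<lambda>n. (real (k n) / real n) powr (2 / real CARD('d)))
            (\<lambda>n. real (k n) powr (- 1 / 2)))"
proof -
  interpret prob_space M by fact
  let ?XY = "\<lambda>i \<omega>. if i = 0 then (X \<omega>, Y \<omega>) else (Xs i \<omega>, Ys i \<omega>)"
  \<comment> \<open>Index \<open>0\<close> holds the generic pair; the sample itself starts at
    \<open>1\<close>, and first components inherit independence.\<close>
  have "indep_vars (\<lambda>_. borel) (\<lambda>i \<omega>. fst (?XY i \<omega>)) {1..}"
    by (rule indep_vars_compose2[OF indep_vars_subset[OF indep], of "{1..}" "\<lambda>_. fst"]) auto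
  then have indep_Xs: "indep_vars (\<lambda>_. borel) Xs {1..}"
    by (rule indep_vars_cong[THEN iffD1, rotated -1]) auto
  have rv: "?XY i \<in> M \<rightarrow>\<^sub>M borel \<Otimes>\<^sub>M S" for i
    using indep unfolding indep_vars_def by blast
  have distr_Xs: "distr M borel (Xs i) = density lborel f" if "i \<ge> 1" for i
  proof -
    have "distr M borel (Xs i) = distr (distr M (borel \<Otimes>\<^sub>M S) (\<lambda>\<omega>. (Xs i \<omega>, Ys i \<omega>))) borel fst"
      using rv[of i] that by (subst distr_distr) (auto simp: comp_def)
    also have "\<dots> = distr (distr M (borel \<Otimes>\<^sub>M S) (\<lambda>\<omega>. (X \<omega>, Y \<omega>))) borel fst"
      using ident[OF that] by simp
    also have "\<dots> = distr M borel X"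
      using rv[of 0] by (subst distr_distr) (auto simp: comp_def)
    \<comment> \<open>\<open>lborel\<close> and \<open>borel\<close> have the same measurable sets,
      which are all that \<open>distr\<close> takes from its target.\<close>
    also have "\<dots> = distr M lborel X"
      by (intro distr_cong) auto
    also have "\<dots> = density lborel f"
      using distributed_distr_eq_density[OF density] by simp
    finally show ?thesis .
  qed
  interpret iid_density_sample M Xs f x k
  proof
    show "f \<in> borel_measurable borel"
      using distributed_real_measurable[OF _ density] f_nonneg by simp
  qed (use indep_Xs distr_Xs f_nonneg f_x k_range k_inf k_n in auto)
  define H where "H = (\<lambda>g w. \<integral>s. g s \<partial>\<mu> w) ` \<G>"
  have dev: "nn_sup_deviation Xs \<mu> \<G> k x = deviation H"
    by (intro ext) (simp add: nn_sup_deviation_def deviation_def H_def image_image)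
  show ?thesis
    unfolding dev
  proof (intro conjI impI)
    assume "\<exists>\<tau>>0. \<exists>L\<^sub>1>0. \<forall>z\<in>cball x \<tau>. \<forall>g\<in>\<G>.
         \<bar>(\<integral>s. g s \<partial>\<mu> x) - (\<integral>s. g s \<partial>\<mu> z)\<bar> \<le> L\<^sub>1 * norm (x - z)"
    then obtain \<tau> L where "\<tau> > 0" "L > 0"
      "\<And>h z. h \<in> H \<Longrightarrow> z \<in> cball x \<tau> \<Longrightarrow> \<bar>h x - h z\<bar> \<le> L * norm (x - z)"
      unfolding H_def by blast
    from deviation_Lipschitz[OF this]
    show "O_P_plus_o_P M (deviation H) (\<lambda>n. (real (k n) / real n) powr (1 / real CARD('d)))
            (\<lambda>n. real (k n) powr (- 1 / 2))" by simp
  next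
    assume A: "(\<exists>\<tau>>0. \<exists>L\<^sub>1>0. \<forall>z\<in>cball x \<tau>. \<forall>g\<in>\<G>.
         \<bar>(\<integral>s. g s \<partial>\<mu> x) - (\<integral>s. g s \<partial>\<mu> z)\<bar> \<le> L\<^sub>1 * norm (x - z))
      \<and> (\<exists>\<tau>>0. \<exists>L\<^sub>2>0. \<forall>z\<in>cball x \<tau>. \<forall>g\<in>\<G>.
         (\<lambda>w. \<integral>s. g s \<partial>\<mu> w) differentiable (at z) \<and>
         norm (gradient (\<lambda>w. \<integral>s. g s \<partial>\<mu> w) x - gradient (\<lambda>w. \<integral>s. g s \<partial>\<mu> w) z) \<le> L\<^sub>2 * norm (x - z))
      \<and> (\<exists>r>0. \<exists>L\<^sub>f. L\<^sub>f-lipschitz_on (ball x r) f)"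
    from A obtain \<tau> L where 1: "\<tau> > 0" "L > 0"
      "\<And>h z. h \<in> H \<Longrightarrow> z \<in> cball x \<tau> \<Longrightarrow> \<bar>h x - h z\<bar> \<le> L * norm (x - z)"
      unfolding H_def by blast
    from A obtain \<tau>' L' where 2: "\<tau>' > 0" "L' > 0"
      "\<And>h z. h \<in> H \<Longrightarrow> z \<in> cball x \<tau>' \<Longrightarrow> h differentiable (at z)"
      "\<And>h z. h \<in> H \<Longrightarrow> z \<in> cball x \<tau>' \<Longrightarrow>
        norm (gradient h x - gradient h z) \<le> L' * norm (x - z)"
      unfolding H_def by blast
    from A obtain \<rho> Lf where 3: "\<rho> > 0" "Lf-lipschitz_on (ball x \<rho>) f"
      by blast
    from deviation_Lipschitz_gradient[OF 1 2 3]
    show "O_P_plus_o_P M (deviation H) (\<lambda>n. (real (k n) / real n) powr (2 / real CARD('d)))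
            (\<lambda>n. real (k n) powr (- 1 / 2))" by simp
  qed
qed

end
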